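(* Let $M$ be a simple smooth $\mathcal{S}$-module of level $\lambda\in\mathbb{C}^*$. Then $M\cong\mathscr{V}^{\sqrt\lambda}\otimes V^{\mathcal{S}}$ for some simple smooth $\mathrm{Vir}$-module $V$ and some $\sqrt\lambda\in\mathbb{C}$ with $(\sqrt\lambda)^2=\lambda$, where $\mathscr{V}^{\sqrt\lambda}$ is considered as an $\mathcal{S}$-module.
   Context: All vector spaces and algebras are over $\mathbb{C}$; $\mathbb{Z}_+$ is the set of non-negative integers, $\mathbb{N}$ the positive integers, $\mathbb{C}^*$ the nonzero complex numbers. Modules over Lie superalgebras are $\mathbb{Z}_2$-graded, and simple means having no nonzero proper graded submodule. The Fermion-Virasoro algebra $\mathcal{S}=\mathcal{S}(0)$ is the Lie superalgebra with basis $\{L_m,\psi_n,c,z:m,n\in\mathbb{Z}\}$, where $L_m,c,z$ are even and $\psi_n$ odd, with $$[L_m,L_n]=(m-n)L_{m+n}+\delta_{m,-n}\tfrac{m^3-m}{12}c,\quad [L_m,\psi_n]=(-n-\tfrac m2)\psi_{m+n},\quad [\psi_m,\psi_n]=\delta_{m,-n}z,$$ and $c,z$ central. It contains $\mathrm{Vir}=\mathrm{span}\{c,L_i:i\in\mathbb{Z}\}$ and $F=\mathrm{span}\{z,\psi_i:i\in\mathbb{Z}\}$. A module has level $\ell$ if $z$ acts as the scalar $\ell$. An $\mathcal{S}$-module $M$ is smooth if for every $v\in M$ there is $n\in\mathbb{Z}_+$ with $L_iv=\psi_iv=0$ for all $i>n$; a $\mathrm{Vir}$-module is smooth if for every $v$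 there is $n$ with $L_iv=0$ for all $i>n$. $\mathscr{V}$ is the exterior algebra generated by odd elements $\xi_i$, $i\in\mathbb{Z}_+$. It is an $F$-module: for $n\in\mathbb{N}$, $\psi_n$ acts as the odd derivation $\partial/\partial\xi_n$, $\psi_{-n}$ as left multiplication by $\xi_n$, $\psi_0$ as $\frac1{\sqrt2}(\xi_0+\partial/\partial\xi_0)$, $z$ as the identity. It is an $\mathcal{S}$-module with $c$ acting as $\frac12$ and $L_k$ acting as $$\bar L_k=\tfrac1{16}\delta_{k,0}+\tfrac12\sum_{j\in\mathbb{Z}}j:\psi_{-j}\psi_{j+k}:,$$ where $:\psi_j\psi_k:\,=\psi_j\psi_k$ if $k\ge j$ and $-\psi_k\psi_j$ if $k<j$ (Kac–Raina–Rozhkovskaya). For $\mu\in\mathbb{C}^*$, $\sigma_\mu$ is the automorphism of $\mathcal{S}$ with $\sigma_\mu(L_k)=L_k$, $\sigma_\mu(\psi_l)=\mu\psi_l$, $\sigma_\mu(c)=c$, $\sigma_\mu(z)=\mu^2z$, and for an $\mathcal{S}$-module $W$, $W^\mu$ is the same space with action $x\cdot v=\sigma_\mu(x)v$. For a $\mathrm{Vir}$-module $V$, $V^{\mathcal{S}}$ denotes $V$ made into an $\mathcal{S}$-module by $F\cdot V=0$. Tensor products are the usual tensor products of modules over a Lie superalgebra. *)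

theory Defs
  imports Complex_Main
    "HOL-Library.Poly_Mapping"
    "HOL-Library.Function_Algebras"
    "HOL-Library.FSet"
    "HOL-Library.Z2"
begin

section \<open>Super vector spaces\<close>

text \<open>
  A super vector space is a pair of independent subspaces (indexed by \<^typ>\<open>bit\<close>, the field with
  two elements) of an ambient complex vector space; only their sum \<open>carr V\<close> matters.
  All linearity conditions below are restricted to carriers.
\<close>

record 'v super_space =
  part :: "bit \<Rightarrow> 'v set"
  scl :: "complex \<Rightarrow> 'v \<Rightarrow> 'v"

definition carr :: "('v::ab_group_add, 'e) super_space_scheme \<Rightarrow> 'v set" where
  "carr V = {a + b | a b. a \<in> part V 0 \<and> b \<in> part V 1}"

definition super_vector_space :: "('v::ab_group_add, 'e) super_space_scheme \<Rightarrow> bool" where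
  "super_vector_space V \<longleftrightarrow>
     vector_space (scl V) \<and>
     (\<forall>i. module.subspace (scl V) (part V i)) \<and>
     part V 0 \<inter> part V 1 = {0}"

definition component :: "('v::ab_group_add, 'e) super_space_scheme \<Rightarrow> bit \<Rightarrow> 'v \<Rightarrow> 'v" where
  "component V i v = (THE a. a \<in> part V i \<and> (\<exists>b \<in> part V (i + 1). v = a + b))"

text \<open>The sign \<open>(-1) ^ (i j)\<close>.\<close>

definition koszul :: "bit \<Rightarrow> bit \<Rightarrow> complex" where
  "koszul i j = (if i * j = 1 then - 1 else 1)"

definition linear_between ::
  "('v::ab_group_add, 'e) super_space_scheme \<Rightarrow> ('w::ab_group_add, 'f) super_space_scheme
     \<Rightarrow> ('v \<Rightarrow> 'w) \<Rightarrow> bool" where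
  "linear_between V W f \<longleftrightarrow>
     (\<forall>v\<in>carr V. f v \<in> carr W) \<and>
     (\<forall>v\<in>carr V. \<forall>v'\<in>carr V. f (v + v') = f v + f v') \<and>
     (\<forall>a. \<forall>v\<in>carr V. f (scl V a v) = scl W a (f v))"

definition bilinear_on ::
  "('u::ab_group_add, 'd) super_space_scheme \<Rightarrow> ('v::ab_group_add, 'e) super_space_scheme
     \<Rightarrow> (complex \<Rightarrow> 'w \<Rightarrow> 'w) \<Rightarrow> ('u \<Rightarrow> 'v \<Rightarrow> 'w::ab_group_add) \<Rightarrow> bool" where
  "bilinear_on U V s f \<longleftrightarrow>
     (\<forall>u\<in>carr U. \<forall>u'\<in>carr U. \<forall>v\<in>carr V. f (u + u') v = f u v + f u' v) \<and>
     (\<forall>u\<in>carr U. \<forall>v\<in>carr V. \<forall>v'\<in>carr V. f u (v + v') = f u v + f u v') \<and>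
     (\<forall>a. \<forall>u\<in>carr U. \<forall>v\<in>carr V. f (scl U a u) v = s a (f u v)) \<and>
     (\<forall>a. \<forall>u\<in>carr U. \<forall>v\<in>carr V. f u (scl V a v) = s a (f u v))"


section \<open>Lie superalgebras and their modules\<close>

record 'x lie_super = "'x super_space" +
  brk :: "'x \<Rightarrow> 'x \<Rightarrow> 'x"

definition lie_superalgebra :: "('x::ab_group_add) lie_super \<Rightarrow> bool" where
  "lie_superalgebra G \<longleftrightarrow>
     super_vector_space G \<and>
     bilinear_on G G (scl G) (brk G) \<and>
     (\<forall>i j. \<forall>x\<in>part G i. \<forall>y\<in>part G j. brk G x y \<in> part G (i + j)) \<and>
     (\<forall>i j. \<forall>x\<in>part G i. \<forall>y\<in>part G j. brk G x y = scl G (- koszul i j) (brk G y x)) \<and>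
     (\<forall>i j k. \<forall>x\<in>part G i. \<forall>y\<in>part G j. \<forall>w\<in>part G k.
        brk G x (brk G y w) = brk G (brk G x y) w + scl G (koszul i j) (brk G y (brk G x w)))"

record ('x, 'v) smodule = "'v super_space" +
  act :: "'x \<Rightarrow> 'v \<Rightarrow> 'v"

definition super_module ::
  "('x::ab_group_add) lie_super \<Rightarrow> ('x, 'v::ab_group_add) smodule \<Rightarrow> bool" where
  "super_module G W \<longleftrightarrow>
     super_vector_space W \<and>
     bilinear_on G W (scl W) (act W) \<and>
     (\<forall>i j. \<forall>x\<in>part G i. \<forall>v\<in>part W j. act W x v \<in> part W (i + j)) \<and>
     (\<forall>i j. \<forall>x\<in>part G i. \<forall>y\<in>part G j. \<forall>v\<in>carr W.
        act W (brk G x y) v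
          = act W x (act W y v) - scl W (koszul i j) (act W y (act W x v)))"

text \<open>The last conjunct says that \<open>U\<close> contains the homogeneous components of its elements.\<close>

definition graded_submodule ::
  "('x::ab_group_add) lie_super \<Rightarrow> ('x, 'v::ab_group_add) smodule \<Rightarrow> 'v set \<Rightarrow> bool" where
  "graded_submodule G W U \<longleftrightarrow>
     module.subspace (scl W) U \<and> U \<subseteq> carr W \<and>
     (\<forall>x\<in>carr G. \<forall>u\<in>U. act W x u \<in> U) \<and>
     (\<forall>a\<in>part W 0. \<forall>b\<in>part W 1. a + b \<in> U \<longrightarrow> a \<in> U \<and> b \<in> U)"

definition simple_module ::
  "('x::ab_group_add) lie_super \<Rightarrow> ('x, 'v::ab_group_add) smodule \<Rightarrow> bool" where
  "simple_module G W \<longleftrightarrow>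
     super_module G W \<and> carr W \<noteq> {0} \<and>
     (\<forall>U. graded_submodule G W U \<longrightarrow> U = {0} \<or> U = carr W)"

text \<open>Isomorphisms are even, that is, they preserve the grading.\<close>

definition module_iso ::
  "('x::ab_group_add) lie_super \<Rightarrow> ('x, 'v::ab_group_add) smodule
     \<Rightarrow> ('x, 'w::ab_group_add) smodule \<Rightarrow> bool" where
  "module_iso G V W \<longleftrightarrow>
     (\<exists>f. linear_between V W f \<and> bij_betw f (carr V) (carr W) \<and>
          (\<forall>i. \<forall>v\<in>part V i. f v \<in> part W i) \<and>
          (\<forall>x\<in>carr G. \<forall>v\<in>carr V. f (act V x v) = act W x (f v)))"


section \<open>Tensor products of modules\<close>

text \<open>
  The tensor product of \<open>A\<close> and \<open>B\<close> is realised inside the dual of the space of bilinear forms on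
  \<open>A \<times> B\<close>: the pure tensor of \<open>a\<close> and \<open>b\<close> is evaluation at \<open>(a, b)\<close>, and the tensor product is the
  span of the pure tensors.  (Its universal property is \<open>tensor_universal\<close> below.)
  The action is the transpose of the corresponding operation on bilinear forms; on pure tensors it
  is the usual one, \<open>x (a \<otimes> b) = x a \<otimes> b + (-1) ^ (|x| |a|) a \<otimes> x b\<close>, see \<open>act_pure_tensor\<close>.
\<close>

type_synonym ('a, 'b) tensor = "('a \<Rightarrow> 'b \<Rightarrow> complex) \<Rightarrow> complex"

definition pure_tensor ::
  "('a::ab_group_add, 'd) super_space_scheme \<Rightarrow> ('b::ab_group_add, 'e) super_space_scheme
     \<Rightarrow> 'a \<Rightarrow> 'b \<Rightarrow> ('a, 'b) tensor" where
  "pure_tensor A B a b = (\<lambda>\<beta>. if bilinear_on A B (*) \<beta> then \<beta> a b else 0)"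

definition tensor_scale :: "complex \<Rightarrow> ('a, 'b) tensor \<Rightarrow> ('a, 'b) tensor" where
  "tensor_scale r t = (\<lambda>\<beta>. r * t \<beta>)"

definition tensor_module ::
  "('x::ab_group_add) lie_super \<Rightarrow> ('x, 'a::ab_group_add) smodule
     \<Rightarrow> ('x, 'b::ab_group_add) smodule \<Rightarrow> ('x, ('a, 'b) tensor) smodule" where
  "tensor_module G A B =
     \<lparr> part = (\<lambda>k. module.span tensor_scale
                 {pure_tensor A B a b | a b i j. a \<in> part A i \<and> b \<in> part B j \<and> i + j = k}),
       scl = tensor_scale,
       act = (\<lambda>x t \<beta>. if bilinear_on A B (*) \<beta>
                then t (\<lambda>a b. \<beta> (act A x a) b +
                          (\<Sum>i\<in>{0, 1}. \<Sum>j\<in>{0, 1}. koszul i j *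
                             \<beta> (component A j a) (act B (component G i x) b)))
                else 0) \<rparr>"


section \<open>The Fermion-Virasoro algebra\<close>

datatype fv_gen = L int | Psi int | C | Z

text \<open>Spaces with a given basis \<open>'k\<close> are represented as \<open>'k \<Rightarrow>\<^sub>0 complex\<close>; \<open>basis_ext s f\<close> is the
  linear map (into a space with scalar multiplication \<open>s\<close>) given by \<open>f\<close> on the basis.\<close>

definition fscale :: "complex \<Rightarrow> ('k \<Rightarrow>\<^sub>0 complex) \<Rightarrow> ('k \<Rightarrow>\<^sub>0 complex)" where
  "fscale r x = Poly_Mapping.map ((*) r) x"

definition basis_ext ::
  "(complex \<Rightarrow> 'v \<Rightarrow> 'v) \<Rightarrow> ('k \<Rightarrow> 'v::ab_group_add) \<Rightarrow> ('k \<Rightarrow>\<^sub>0 complex) \<Rightarrow> 'v" where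
  "basis_ext s f x = (\<Sum>g\<in>Poly_Mapping.keys x. s (Poly_Mapping.lookup x g) (f g))"

abbreviation bv :: "'k \<Rightarrow> ('k \<Rightarrow>\<^sub>0 complex)" where
  "bv g \<equiv> Poly_Mapping.single g 1"

type_synonym fv = "fv_gen \<Rightarrow>\<^sub>0 complex"

fun gen_parity :: "fv_gen \<Rightarrow> bit" where
  "gen_parity (Psi n) = 1"
| "gen_parity (L m) = 0"
| "gen_parity C = 0"
| "gen_parity Z = 0"

fun gen_bracket :: "fv_gen \<Rightarrow> fv_gen \<Rightarrow> fv" where
  "gen_bracket (L m) (L n) = fscale (of_int (m - n)) (bv (L (m + n)))
     + (if m = - n then fscale ((of_int m ^ 3 - of_int m) / 12) (bv C) else 0)"
| "gen_bracket (L m) (Psi n) = fscale (- of_int n - of_int m / 2) (bv (Psi (m + n)))"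
| "gen_bracket (Psi n) (L m) = fscale (of_int n + of_int m / 2) (bv (Psi (m + n)))"
| "gen_bracket (Psi m) (Psi n) = (if m = - n then bv Z else 0)"
| "gen_bracket _ _ = 0"

definition fermion_virasoro :: "fv lie_super" where
  "fermion_virasoro =
     \<lparr> part = (\<lambda>i. {x. \<forall>g\<in>Poly_Mapping.keys x. gen_parity g = i}),
       scl = fscale,
       brk = (\<lambda>x y. basis_ext fscale (\<lambda>g. basis_ext fscale (gen_bracket g) y) x) \<rparr>"

text \<open>The subalgebra \<open>Vir\<close>, regarded as a Lie superalgebra with zero odd part.\<close>

definition virasoro :: "fv lie_super" where
  "virasoro = fermion_virasoro
     \<lparr> part := (\<lambda>i. if i = 0 then {x. Poly_Mapping.keys x \<subseteq> insert C (range L)} else {0}) \<rparr>"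

definition has_level :: "(fv, 'v::ab_group_add) smodule \<Rightarrow> complex \<Rightarrow> bool" where
  "has_level W l \<longleftrightarrow> (\<forall>v\<in>carr W. act W (bv Z) v = scl W l v)"

definition smooth_fv :: "(fv, 'v::ab_group_add) smodule \<Rightarrow> bool" where
  "smooth_fv W \<longleftrightarrow> (\<forall>v\<in>carr W. \<exists>n::nat. \<forall>i>int n. act W (bv (L i)) v = 0 \<and> act W (bv (Psi i)) v = 0)"

definition smooth_vir :: "(fv, 'v::ab_group_add) smodule \<Rightarrow> bool" where
  "smooth_vir W \<longleftrightarrow> (\<forall>v\<in>carr W. \<exists>n::nat. \<forall>i>int n. act W (bv (L i)) v = 0)"

fun sigma_gen :: "complex \<Rightarrow> fv_gen \<Rightarrow> fv" where
  "sigma_gen \<mu> (L k) = bv (L k)"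
| "sigma_gen \<mu> (Psi l) = fscale \<mu> (bv (Psi l))"
| "sigma_gen \<mu> C = bv C"
| "sigma_gen \<mu> Z = fscale (\<mu>\<^sup>2) (bv Z)"

definition sigma :: "complex \<Rightarrow> fv \<Rightarrow> fv" where
  "sigma \<mu> = basis_ext fscale (sigma_gen \<mu>)"

definition twist :: "complex \<Rightarrow> (fv, 'v) smodule \<Rightarrow> (fv, 'v) smodule" where
  "twist \<mu> W = W \<lparr> act := (\<lambda>x. act W (sigma \<mu> x)) \<rparr>"

text \<open>The projection onto \<open>Vir\<close> along \<open>F\<close>; inflation along it is the construction \<open>V\<^sup>S\<close>.\<close>

fun vir_proj_gen :: "fv_gen \<Rightarrow> fv" where
  "vir_proj_gen (L k) = bv (L k)"
| "vir_proj_gen C = bv C"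
| "vir_proj_gen (Psi l) = 0"
| "vir_proj_gen Z = 0"

definition inflate :: "(fv, 'v) smodule \<Rightarrow> (fv, 'v) smodule" where
  "inflate V = V \<lparr> act := (\<lambda>x. act V (basis_ext fscale vir_proj_gen x)) \<rparr>"


section \<open>The fermionic Fock space\<close>

text \<open>
  The exterior algebra on \<open>\<xi>\<^sub>0, \<xi>\<^sub>1, \<dots>\<close>: the basis vector of a finite set is the wedge product of the
  corresponding generators in increasing order.
\<close>

type_synonym ext = "nat fset \<Rightarrow>\<^sub>0 complex"

definition wedge_basis :: "nat fset \<Rightarrow> nat fset \<Rightarrow> ext" where
  "wedge_basis S T = (if S |\<inter>| T = {||}
     then fscale ((- 1) ^ card {(s, t). s |\<in>| S \<and> t |\<in>| T \<and> t < s}) (bv (S |\<union>| T)) else 0)"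

definition wedge :: "ext \<Rightarrow> ext \<Rightarrow> ext" where
  "wedge x y = basis_ext fscale (\<lambda>S. basis_ext fscale (wedge_basis S) y) x"

definition xi :: "nat \<Rightarrow> ext" where
  "xi n = bv {|n|}"

text \<open>The odd derivation \<open>\<partial>/\<partial>\<xi>\<^sub>n\<close>: on a monomial it deletes the factor \<open>\<xi>\<^sub>n\<close>, with a sign for each
  generator to its left.\<close>

definition d_xi :: "nat \<Rightarrow> ext \<Rightarrow> ext" where
  "d_xi n = basis_ext fscale (\<lambda>S. if n |\<in>| S
     then fscale ((- 1) ^ card {s. s |\<in>| S \<and> s < n}) (bv (S |-| {|n|})) else 0)"

definition ext_part :: "bit \<Rightarrow> ext set" where
  "ext_part i = {x. \<forall>S\<in>Poly_Mapping.keys x. even (fcard S) \<longleftrightarrow> i = 0}"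

definition fock_psi :: "int \<Rightarrow> ext \<Rightarrow> ext" where
  "fock_psi n v =
     (if n > 0 then d_xi (nat n) v
      else if n < 0 then wedge (xi (nat (- n))) v
      else fscale (1 / of_real (sqrt 2)) (wedge (xi 0) v + d_xi 0 v))"

definition normal_ordered :: "int \<Rightarrow> int \<Rightarrow> ext \<Rightarrow> ext" where
  "normal_ordered j k v =
     (if k \<ge> j then fock_psi j (fock_psi k v) else - fock_psi k (fock_psi j v))"

text \<open>For each \<open>v\<close> only finitely many summands are nonzero (\<open>finite_normal_ordered\<close>), so
  \<^const>\<open>Sum_any\<close> is the actual sum over all integers.\<close>

definition fock_L :: "int \<Rightarrow> ext \<Rightarrow> ext" where
  "fock_L k v = fscale (if k = 0 then 1 / 16 else 0) v
     + fscale (1 / 2) (Sum_any (\<lambda>j::int. fscale (of_int j) (normal_ordered (- j) (j + k) v)))"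

fun fock_gen :: "fv_gen \<Rightarrow> ext \<Rightarrow> ext" where
  "fock_gen (L k) v = fock_L k v"
| "fock_gen (Psi n) v = fock_psi n v"
| "fock_gen C v = fscale (1 / 2) v"
| "fock_gen Z v = v"

definition fock :: "(fv, ext) smodule" where
  "fock = \<lparr> part = ext_part, scl = fscale,
            act = (\<lambda>x v. basis_ext fscale (\<lambda>g. fock_gen g v) x) \<rparr>"


section \<open>Basic facts\<close>

subsection \<open>Linear extension\<close>

lemma lookup_fscale [simp]: "Poly_Mapping.lookup (fscale r x) k = r * Poly_Mapping.lookup x k"
  by (simp add: fscale_def Poly_Mapping.map.rep_eq when_def)

lemma vector_space_fscale: "vector_space fscale"
  by unfold_locales (auto intro!: poly_mapping_eqI simp: lookup_add algebra_simps)

interpretation fs: vector_space fscale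
  by (rule vector_space_fscale)

lemma basis_ext_superset:
  assumes "vector_space s" "finite K" "Poly_Mapping.keys x \<subseteq> K"
  shows "basis_ext s f x = (\<Sum>g\<in>K. s (Poly_Mapping.lookup x g) (f g))"
proof -
  interpret vector_space s by fact
  show ?thesis unfolding basis_ext_def
    by (rule sum.mono_neutral_left) (use assms in \<open>auto simp: in_keys_iff\<close>)
qed

lemma basis_ext_single:
  assumes "vector_space s"
  shows "basis_ext s f (bv g) = f g"
proof -
  interpret vector_space s by fact
  show ?thesis by (simp add: basis_ext_def)
qed

lemma basis_ext_add:
  assumes "vector_space s"
  shows "basis_ext s f (x + y) = basis_ext s f x + basis_ext s f y"
proof -
  interpret vector_space s by fact
  let ?K = "Poly_Mapping.keys x \<union> Poly_Mapping.keys y"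
  have "Poly_Mapping.keys (x + y) \<subseteq> ?K" by (rule keys_add)
  then show ?thesis
    using basis_ext_superset[OF assms, of ?K "x + y" f] basis_ext_superset[OF assms, of ?K x f]
      basis_ext_superset[OF assms, of ?K y f]
    by (simp add: lookup_add scale_left_distrib sum.distrib)
qed

lemma basis_ext_scale:
  assumes "vector_space s"
  shows "basis_ext s f (fscale r x) = s r (basis_ext s f x)"
proof -
  interpret vector_space s by fact
  have "Poly_Mapping.keys (fscale r x) \<subseteq> Poly_Mapping.keys x" by (auto simp: in_keys_iff)
  then show ?thesis
    using basis_ext_superset[OF assms, of "Poly_Mapping.keys x" "fscale r x" f]
    by (simp add: basis_ext_def scale_sum_right)
qed

lemma basis_ext_zero [simp]: "basis_ext s f 0 = 0"
  by (simp add: basis_ext_def)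

lemma basis_ext_fun_add:
  assumes "vector_space s"
  shows "basis_ext s (\<lambda>g. f g + h g) x = basis_ext s f x + basis_ext s h x"
proof -
  interpret vector_space s by fact
  show ?thesis by (simp add: basis_ext_def scale_right_distrib sum.distrib)
qed

lemma basis_ext_fun_scale:
  assumes "vector_space s"
  shows "basis_ext s (\<lambda>g. s r (f g)) x = s r (basis_ext s f x)"
proof -
  interpret vector_space s by fact
  show ?thesis by (simp add: basis_ext_def scale_sum_right mult.commute)
qed

lemma finsupp_induct [case_names zero basis add scale]:
  fixes x :: "'k \<Rightarrow>\<^sub>0 complex"
  assumes "P 0" and "\<And>g. g \<in> Poly_Mapping.keys x \<Longrightarrow> P (bv g)"
    and "\<And>u v. P u \<Longrightarrow> P v \<Longrightarrow> P (u + v)" and "\<And>r u. P u \<Longrightarrow> P (fscale r u)"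
  shows "P x"
proof -
  have "x = (\<Sum>g\<in>Poly_Mapping.keys x. fscale (Poly_Mapping.lookup x g) (bv g))"
    by (rule poly_mapping_eqI)
       (simp add: lookup_sum lookup_single when_def in_keys_iff if_distrib sum.delta cong: if_cong)
  moreover have "P (\<Sum>g\<in>K. fscale (Poly_Mapping.lookup x g) (bv g))"
    if "finite K" "K \<subseteq> Poly_Mapping.keys x" for K
    using that by (induction K rule: finite_induct) (auto intro: assms)
  ultimately show ?thesis by (metis finite_keys order_refl)
qed

lemma linear_eq_on_basis:
  fixes F F' :: "('k \<Rightarrow>\<^sub>0 complex) \<Rightarrow> ('l \<Rightarrow>\<^sub>0 complex)"
  assumes "\<And>u v. F (u + v) = F u + F v" "\<And>r u. F (fscale r u) = fscale r (F u)"
    and "\<And>u v. F' (u + v) = F' u + F' v" "\<And>r u. F' (fscale r u) = fscale r (F' u)"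
    and "\<And>g. g \<in> Poly_Mapping.keys x \<Longrightarrow> F (bv g) = F' (bv g)"
  shows "F x = F' x"
proof (induction x rule: finsupp_induct)
  case zero
  show ?case using assms(2)[of 0 0] assms(4)[of 0 0] by simp
qed (simp_all add: assms)

subsection \<open>The Fermion-Virasoro algebra is a Lie superalgebra\<close>

abbreviation fvb :: "fv \<Rightarrow> fv \<Rightarrow> fv" where
  "fvb \<equiv> brk fermion_virasoro"

lemma fvb_basis: "fvb (bv g) (bv h) = gen_bracket g h"
  by (simp add: fermion_virasoro_def basis_ext_single vector_space_fscale)

lemma fvb_linear:
  "fvb (x + x') y = fvb x y + fvb x' y"
  "fvb x (y + y') = fvb x y + fvb x y'"
  "fvb (fscale r x) y = fscale r (fvb x y)"
  "fvb x (fscale r y) = fscale r (fvb x y)"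
  "fvb 0 y = 0" "fvb x 0 = 0"
proof -
  note * = basis_ext_add[OF vector_space_fscale] basis_ext_scale[OF vector_space_fscale]
    basis_ext_fun_add[OF vector_space_fscale] basis_ext_fun_scale[OF vector_space_fscale]
  show "fvb (x + x') y = fvb x y + fvb x' y" "fvb (fscale r x) y = fscale r (fvb x y)"
    "fvb 0 y = 0" "fvb x 0 = 0"
    by (simp_all add: fermion_virasoro_def *) (simp add: basis_ext_def)
  show "fvb x (y + y') = fvb x y + fvb x y'" "fvb x (fscale r y) = fscale r (fvb x y)"
    by (simp_all only: fermion_virasoro_def lie_super.simps *)
qed

lemma fv_part_iff:
  "x \<in> part fermion_virasoro i \<longleftrightarrow> (\<forall>g\<in>Poly_Mapping.keys x. gen_parity g = i)"
  by (simp add: fermion_virasoro_def)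

lemma scl_fv [simp]: "scl fermion_virasoro = fscale"
  by (simp add: fermion_virasoro_def)

lemma subspace_keys: "fs.subspace {x. \<forall>g\<in>Poly_Mapping.keys x. P g}"
  unfolding fs.subspace_def
  by (auto simp: in_keys_iff lookup_add)

lemma subspace_fv_part: "fs.subspace (part fermion_virasoro i)"
  unfolding fermion_virasoro_def by (simp add: subspace_keys)

lemma bv_in_part: "gen_parity g = i \<Longrightarrow> bv g \<in> part fermion_virasoro i"
  by (simp add: fv_part_iff)

lemma gen_bracket_parity: "gen_bracket g h \<in> part fermion_virasoro (gen_parity g + gen_parity h)"
  by (cases g; cases h)
     (auto intro!: bv_in_part fs.subspace_0 fs.subspace_add fs.subspace_diff fs.subspace_scale subspace_fv_part)

lemma gen_bracket_skew:
  "gen_bracket g h = fscale (- koszul (gen_parity g) (gen_parity h)) (gen_bracket h g)"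
  by (cases g; cases h)
     (auto intro!: poly_mapping_eqI simp: koszul_def lookup_add lookup_single when_def
        add.commute field_simps split: if_splits)

lemma fv_jacobi_basis:
  "fvb (bv g) (fvb (bv h) (bv k)) = fvb (fvb (bv g) (bv h)) (bv k)
     + fscale (koszul (gen_parity g) (gen_parity h)) (fvb (bv h) (fvb (bv g) (bv k)))"
  apply (cases g; cases h; cases k)
  apply (simp_all add: fvb_basis fvb_linear koszul_def)
  apply (auto intro!: poly_mapping_eqI simp: lookup_add lookup_minus lookup_single when_def add_ac)
  apply (simp_all add: field_simps power3_eq_cube)
  done

lemma super_vector_space_fv: "super_vector_space fermion_virasoro"
proof -
  have "x = 0" if "x \<in> part fermion_virasoro 0" "x \<in> part fermion_virasoro 1" for x
  proof -
    have "Poly_Mapping.keys x = {}"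
      using that unfolding fv_part_iff by (metis equals0I zero_neq_one)
    then show ?thesis by simp
  qed
  moreover have "0 \<in> part fermion_virasoro i" for i
    by (simp add: fv_part_iff)
  ultimately show ?thesis
    unfolding super_vector_space_def by (auto simp: vector_space_fscale subspace_fv_part)
qed

lemma fv_jacobi:
  assumes "x \<in> part fermion_virasoro i" "y \<in> part fermion_virasoro j"
  shows "fvb x (fvb y w) = fvb (fvb x y) w + fscale (koszul i j) (fvb y (fvb x w))"
proof -
  have 1: "fvb (bv g) (fvb (bv h) w) = fvb (fvb (bv g) (bv h)) w
     + fscale (koszul (gen_parity g) (gen_parity h)) (fvb (bv h) (fvb (bv g) w))" for g h w
    by (rule linear_eq_on_basis[where x = w])
       (rule fv_jacobi_basis | simp add: fvb_linear fs.scale_right_distrib mult.commute add_ac)+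
  have 2: "fvb (bv g) (fvb y w) = fvb (fvb (bv g) y) w
     + fscale (koszul (gen_parity g) j) (fvb y (fvb (bv g) w))" for g w
  proof (rule linear_eq_on_basis[where x = y])
    fix h assume "h \<in> Poly_Mapping.keys y"
    then have "gen_parity h = j" using assms(2) by (simp add: fv_part_iff)
    then show "fvb (bv g) (fvb (bv h) w) = fvb (fvb (bv g) (bv h)) w
      + fscale (koszul (gen_parity g) j) (fvb (bv h) (fvb (bv g) w))"
      using 1[of g h w] by metis
  qed (simp_all add: fvb_linear fs.scale_right_distrib mult.commute add_ac)
  show ?thesis
  proof (rule linear_eq_on_basis[where x = x])
    fix g assume "g \<in> Poly_Mapping.keys x"
    then have "gen_parity g = i" using assms(1) by (simp add: fv_part_iff)
    then show "fvb (bv g) (fvb y w) = fvb (fvb (bv g) y) w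
      + fscale (koszul i j) (fvb y (fvb (bv g) w))"
      using 2[of g w] by metis
  qed (simp_all add: fvb_linear fs.scale_right_distrib mult.commute add_ac)
qed

lemma zero_in_fv_part [simp]: "0 \<in> part fermion_virasoro i"
  by (simp add: fv_part_iff)

lemma fvb_parity:
  assumes "x \<in> part fermion_virasoro i" "y \<in> part fermion_virasoro j"
  shows "fvb x y \<in> part fermion_virasoro (i + j)"
proof -
  note clo = fs.subspace_add[OF subspace_fv_part] fs.subspace_scale[OF subspace_fv_part]
  have 1: "fvb (bv g) y \<in> part fermion_virasoro (gen_parity g + j)" for g
  proof (induction y rule: finsupp_induct)
    case (basis h)
    then have "gen_parity h = j" using assms(2) by (simp add: fv_part_iff)
    then show ?case using gen_bracket_parity[of g h] by (simp add: fvb_basis)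
  qed (simp_all add: fvb_linear clo)
  show ?thesis
  proof (induction x rule: finsupp_induct)
    case (basis g)
    then have "gen_parity g = i" using assms(1) by (simp add: fv_part_iff)
    then show ?case using 1[of g] by simp
  qed (simp_all add: fvb_linear clo)
qed

lemma fvb_skew:
  assumes "x \<in> part fermion_virasoro i" "y \<in> part fermion_virasoro j"
  shows "fvb x y = fscale (- koszul i j) (fvb y x)"
proof -
  have 1: "fvb (bv g) y = fscale (- koszul (gen_parity g) j) (fvb y (bv g))" for g
  proof (rule linear_eq_on_basis[where x = y])
    fix h assume "h \<in> Poly_Mapping.keys y"
    then have "gen_parity h = j" using assms(2) by (simp add: fv_part_iff)
    then show "fvb (bv g) (bv h) = fscale (- koszul (gen_parity g) j) (fvb (bv h) (bv g))"
      using gen_bracket_skew[of g h] by (simp add: fvb_basis)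
  qed (simp_all add: fvb_linear fs.scale_right_distrib mult.commute)
  show ?thesis
  proof (rule linear_eq_on_basis[where x = x])
    fix g assume "g \<in> Poly_Mapping.keys x"
    then have "gen_parity g = i" using assms(1) by (simp add: fv_part_iff)
    then show "fvb (bv g) y = fscale (- koszul i j) (fvb y (bv g))"
      using 1[of g] by metis
  qed (simp_all add: fvb_linear fs.scale_right_distrib mult.commute)
qed

theorem lie_superalgebra_fermion_virasoro: "lie_superalgebra fermion_virasoro"
  unfolding lie_superalgebra_def bilinear_on_def scl_fv
  by (intro conjI allI ballI super_vector_space_fv fvb_linear fvb_parity fvb_skew fv_jacobi)

lemma virasoro_sel [simp]: "scl virasoro = fscale" "brk virasoro = fvb"
  by (simp_all add: virasoro_def fermion_virasoro_def)

lemma virasoro_part: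
  "part virasoro i = (if i = 0 then {x. \<forall>g\<in>Poly_Mapping.keys x. g \<in> insert C (range L)} else {0})"
  by (auto simp: virasoro_def)

lemma virasoro_part_subset: "part virasoro i \<subseteq> part fermion_virasoro i"
proof
  fix x assume x: "x \<in> part virasoro i"
  have "gen_parity g = i" if "g \<in> Poly_Mapping.keys x" for g
  proof -
    have "i = 0" "g \<in> insert C (range L)"
      using x that by (auto simp: virasoro_part split: if_splits)
    then show ?thesis by auto
  qed
  then show "x \<in> part fermion_virasoro i" by (simp add: fv_part_iff)
qed

lemma subspace_virasoro_part: "fs.subspace (part virasoro i)"
  using subspace_keys[of "\<lambda>g. g \<in> insert C (range L)"] by (simp add: virasoro_part)

lemma virasoro_closed:
  assumes "x \<in> part virasoro 0" "y \<in> part virasoro 0"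
  shows "fvb x y \<in> part virasoro 0"
proof -
  note clo = fs.subspace_add[OF subspace_virasoro_part] fs.subspace_diff[OF subspace_virasoro_part]
    fs.subspace_scale[OF subspace_virasoro_part] fs.subspace_0[OF subspace_virasoro_part]
  have bv_in: "g \<in> insert C (range L) \<Longrightarrow> bv g \<in> part virasoro 0" for g
    by (auto simp: virasoro_part)
  have 0: "gen_bracket g h \<in> part virasoro 0"
    if "g \<in> insert C (range L)" "h \<in> insert C (range L)" for g h
    using that by (auto intro!: clo bv_in)
  have 1: "fvb (bv g) y \<in> part virasoro 0" if g: "g \<in> insert C (range L)" for g
  proof (induction y rule: finsupp_induct)
    case (basis h)
    then have "h \<in> insert C (range L)" using assms(2) by (simp add: virasoro_part)
    then show ?case using 0[OF g] by (simp add: fvb_basis)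
  qed (simp_all add: fvb_linear clo)
  show ?thesis
  proof (induction x rule: finsupp_induct)
    case (basis g)
    then have "g \<in> insert C (range L)" using assms(1) by (simp add: virasoro_part)
    then show ?case by (rule 1)
  qed (simp_all add: fvb_linear clo)
qed

lemma lie_superalgebra_virasoro: "lie_superalgebra virasoro"
proof -
  have "super_vector_space virasoro"
    using subspace_virasoro_part
    by (auto simp: super_vector_space_def vector_space_fscale virasoro_part)
  moreover have "fvb x y \<in> part virasoro (i + j)"
    if "x \<in> part virasoro i" "y \<in> part virasoro j" for x y i j
    using that virasoro_closed[of x y] fs.subspace_0[OF subspace_virasoro_part]
    by (cases i; cases j) (auto simp: fvb_linear virasoro_part split: if_splits)
  ultimately show ?thesis
    unfolding lie_superalgebra_def bilinear_on_def virasoro_sel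
    by (intro conjI allI ballI fvb_linear fvb_skew fv_jacobi;
        blast intro: subsetD[OF virasoro_part_subset])
qed

subsection \<open>Tensor products\<close>

interpretation ts: vector_space "tensor_scale :: complex \<Rightarrow> ('a, 'b) tensor \<Rightarrow> ('a, 'b) tensor"
  by unfold_locales (auto simp: tensor_scale_def fun_eq_iff algebra_simps)

lemma bilinear_pure_tensor: "bilinear_on A B tensor_scale (pure_tensor A B)"
  by (auto simp: bilinear_on_def pure_tensor_def tensor_scale_def fun_eq_iff)

lemma component_eq:
  assumes "super_vector_space V" "a \<in> part V i" "b \<in> part V (i + 1)"
  shows "component V i (a + b) = a"
proof -
  interpret vector_space "scl V" using assms by (simp add: super_vector_space_def)
  have sub: "subspace (part V k)" for k using assms by (simp add: super_vector_space_def)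
  have cap: "part V i \<inter> part V (i + 1) = {0}"
    using assms by (cases i) (auto simp: super_vector_space_def)
  show ?thesis unfolding component_def
  proof (rule the_equality)
    fix a' assume a': "a' \<in> part V i \<and> (\<exists>b'\<in>part V (i + 1). a + b = a' + b')"
    then obtain b' where b': "b' \<in> part V (i + 1)" "a' - a = b - b'"
      by (metis add_diff_cancel_right' add_diff_cancel_left' diff_add_eq diff_diff_eq2 add.commute)
    have "a' - a \<in> part V i" "b - b' \<in> part V (i + 1)"
      using a' b'(1) assms by (blast intro: subspace_diff sub)+
    then have "a' - a = 0" using cap unfolding b'(2) by blast
    then show "a' = a" by simp
  qed (use assms in auto)
qed

lemma part_subset_carr:
  assumes "super_vector_space V"
  shows "part V i \<subseteq> carr V"
proof -
  interpret vector_space "scl V" using assms by (simp add: super_vector_space_def)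
  have "0 \<in> part V k" for k using assms by (simp add: super_vector_space_def subspace_0)
  then show ?thesis unfolding carr_def
    by (cases i) (force intro: add_0_right[symmetric] add_0_left[symmetric])+
qed

lemma carr_decompose:
  assumes "super_vector_space V" "v \<in> carr V"
  obtains a b where "a \<in> part V i" "b \<in> part V (i + 1)" "v = a + b"
  using assms(2) unfolding carr_def by (cases i) (auto simp: add.commute)

lemma subspace_carr:
  assumes "super_vector_space V"
  shows "module.subspace (scl V) (carr V)"
proof -
  interpret vector_space "scl V" using assms by (simp add: super_vector_space_def)
  show ?thesis
    unfolding carr_def using subspace_sums[of "part V 0" "part V 1"] assms
    by (simp add: super_vector_space_def)
qed

lemma component_props:
  assumes V: "super_vector_space V" and v: "v \<in> carr V"
  shows "component V i v \<in> part V i"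
    and "v' \<in> carr V \<Longrightarrow> component V i (v + v') = component V i v + component V i v'"
    and "component V i (scl V r v) = scl V r (component V i v)"
proof -
  interpret vector_space "scl V" using V by (simp add: super_vector_space_def)
  have sub: "subspace (part V k)" for k using V by (simp add: super_vector_space_def)
  obtain a b where ab: "a \<in> part V i" "b \<in> part V (i + 1)" "v = a + b"
    using carr_decompose[OF V v] .
  show "component V i v \<in> part V i" using ab component_eq[OF V ab(1,2)] by simp
  show "component V i (scl V r v) = scl V r (component V i v)"
    using ab component_eq[OF V ab(1,2)]
      component_eq[OF V subspace_scale[OF sub ab(1), of r] subspace_scale[OF sub ab(2), of r]]
    by (simp add: scale_right_distrib)
  assume "v' \<in> carr V"
  then obtain a' b' where ab': "a' \<in> part V i" "b' \<in> part V (i + 1)" "v' = a' + b'"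
    using carr_decompose[OF V] by blast
  show "component V i (v + v') = component V i v + component V i v'"
    using ab ab' component_eq[OF V ab(1,2)] component_eq[OF V ab'(1,2)]
      component_eq[OF V subspace_add[OF sub ab(1) ab'(1)] subspace_add[OF sub ab(2) ab'(2)]]
    by (simp add: algebra_simps)
qed

lemma component_homogeneous:
  assumes V: "super_vector_space V" and v: "v \<in> part V i"
  shows "component V k v = (if k = i then v else 0)"
proof -
  interpret vector_space "scl V" using V by (simp add: super_vector_space_def)
  have 0: "0 \<in> part V k" for k using V by (simp add: super_vector_space_def subspace_0)
  show ?thesis
    using component_eq[OF V v 0] component_eq[OF V 0, of v "i + 1"] v
    by (cases i; cases k) auto
qed

lemma super_module_actD:
  assumes "super_module G W" "super_vector_space G" "x \<in> carr G"
  shows "v \<in> carr W \<Longrightarrow> act W x v \<in> carr W"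
    and "v \<in> carr W \<Longrightarrow> v' \<in> carr W \<Longrightarrow> act W x (v + v') = act W x v + act W x v'"
    and "v \<in> carr W \<Longrightarrow> act W x (scl W r v) = scl W r (act W x v)"
proof -
  have W: "super_vector_space W" and bil: "bilinear_on G W (scl W) (act W)"
    and gr: "\<And>i j x v. x \<in> part G i \<Longrightarrow> v \<in> part W j \<Longrightarrow> act W x v \<in> part W (i + j)"
    using assms(1) by (auto simp: super_module_def)
  interpret vector_space "scl W" using W by (simp add: super_vector_space_def)
  note sub = subspace_carr[OF W] and inc = subsetD[OF part_subset_carr[OF W]]
    and incG = subsetD[OF part_subset_carr[OF assms(2)]]
  show add: "v \<in> carr W \<Longrightarrow> v' \<in> carr W \<Longrightarrow> act W x (v + v') = act W x v + act W x v'"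
    and "v \<in> carr W \<Longrightarrow> act W x (scl W r v) = scl W r (act W x v)"
    using bil assms(3) by (auto simp: bilinear_on_def)
  assume v: "v \<in> carr W"
  obtain a b where ab: "a \<in> part G 0" "b \<in> part G (0 + 1)" "x = a + b"
    using carr_decompose[OF assms(2,3)] .
  obtain c d where cd: "c \<in> part W 0" "d \<in> part W (0 + 1)" "v = c + d"
    using carr_decompose[OF W v] .
  have "act W x v = (act W a c + act W b c) + (act W a d + act W b d)"
    using bil ab cd inc incG v assms(3) by (auto simp: bilinear_on_def)
  also have "\<dots> \<in> carr W"
    using ab cd by (intro subspace_add[OF sub] inc) (auto intro: gr)
  finally show "act W x v \<in> carr W" .
qed

theorem act_pure_tensor:
  assumes G: "super_vector_space G" and A: "super_module G A" and B: "super_module G B"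
    and x: "x \<in> part G i" and a: "a \<in> part A j" and b: "b \<in> carr B"
  shows "act (tensor_module G A B) x (pure_tensor A B a b) =
           pure_tensor A B (act A x a) b
             + tensor_scale (koszul i j) (pure_tensor A B a (act B x b))"
proof
  fix \<beta> :: "'b \<Rightarrow> 'c \<Rightarrow> complex"
  have A': "super_vector_space A" and B': "super_vector_space B"
    using A B by (auto simp: super_module_def)
  define \<beta>' where "\<beta>' = (\<lambda>a b. \<beta> (act A x a) b +
     (\<Sum>i\<in>{0, 1}. \<Sum>j\<in>{0, 1}. koszul i j *
        \<beta> (component A j a) (act B (component G i x) b)))"
  have xG: "x \<in> carr G" and aA: "a \<in> carr A"
    using x a part_subset_carr[OF G] part_subset_carr[OF A'] by auto
  note memA = super_module_actD[OF A G xG] subsetD[OF part_subset_carr[OF A'] component_props(1)[OF A']]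
  have memG: "component G k x \<in> carr G" for k
    using subsetD[OF part_subset_carr[OF G] component_props(1)[OF G xG]] .
  note memB = super_module_actD[OF B G memG]
  show "act (tensor_module G A B) x (pure_tensor A B a b) \<beta> =
          (pure_tensor A B (act A x a) b
             + tensor_scale (koszul i j) (pure_tensor A B a (act B x b))) \<beta>"
  proof (cases "bilinear_on A B (*) \<beta>")
    case True
    have "bilinear_on A B (*) \<beta>'"
      using True unfolding bilinear_on_def \<beta>'_def
      by (simp add: memA memB component_props[OF A'] algebra_simps)
    moreover have "\<beta>' a b = \<beta> (act A x a) b + koszul i j * \<beta> a (act B x b)"
    proof -
      interpret gs: vector_space "scl G" using G by (simp add: super_vector_space_def)
      interpret as: vector_space "scl A" using A' by (simp add: super_vector_space_def)
      interpret bs: vector_space "scl B" using B' by (simp add: super_vector_space_def)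
      have "act B (scl G 0 x) b = scl B 0 (act B x b)"
        using B xG b unfolding super_module_def bilinear_on_def by blast
      then have a0: "act B 0 b = 0" by simp
      moreover have "\<beta> a (scl B 0 b) = 0 * \<beta> a b"
        using True aA b unfolding bilinear_on_def by blast
      moreover have "\<beta> (scl A 0 a) v = 0 * \<beta> a v" if "v \<in> carr B" for v
        using True aA that unfolding bilinear_on_def by blast
      ultimately have 0: "\<beta> a 0 = 0" "v \<in> carr B \<Longrightarrow> \<beta> 0 v = 0" for v
        by simp_all
      have "act B x b \<in> carr B" "0 \<in> carr B"
        using super_module_actD(1)[OF B G xG b] subspace_carr[OF B'] by (auto intro: bs.subspace_0)
      note 0 = 0(1) this[THEN 0(2)] a0
      show ?thesis
        unfolding \<beta>'_def component_homogeneous[OF G x] component_homogeneous[OF A' a]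
        by (cases i; cases j) (auto simp: 0)
    qed
    moreover have "act (tensor_module G A B) x (pure_tensor A B a b) \<beta> = pure_tensor A B a b \<beta>'"
      using True by (simp only: tensor_module_def smodule.simps \<beta>'_def if_True)
    ultimately show ?thesis
      using True by (simp add: pure_tensor_def tensor_scale_def)
  qed (simp add: tensor_module_def pure_tensor_def tensor_scale_def)
qed

lemma carr_tensor:
  assumes "super_vector_space A" "super_vector_space B"
  shows "carr (tensor_module G A B) =
           ts.span {pure_tensor A B a b | a b. a \<in> carr A \<and> b \<in> carr B}" (is "_ = ts.span ?P")
proof -
  let ?T = "tensor_module G A B"
  have part: "part ?T k =
      ts.span {pure_tensor A B a b | a b i j. a \<in> part A i \<and> b \<in> part B j \<and> i + j = k}" for k
    by (simp add: tensor_module_def)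
  have le: "part ?T k \<subseteq> ts.span ?P" for k
    unfolding part
    using part_subset_carr[OF assms(1)] part_subset_carr[OF assms(2)] by (intro ts.span_mono) blast
  have sub: "ts.subspace (carr ?T)"
    unfolding carr_def by (rule ts.subspace_sums) (simp_all add: part)
  have inc: "part ?T k \<subseteq> carr ?T" for k
  proof -
    have "0 \<in> part ?T l" for l by (simp add: part ts.span_zero)
    then show ?thesis unfolding carr_def
      by (cases k) (force intro: add_0_right[symmetric] add_0_left[symmetric])+
  qed
  have hom: "pure_tensor A B a b \<in> carr ?T" if "a \<in> part A i" "b \<in> part B j" for a b i j
    using that inc[of "i + j"] unfolding part by (blast intro: ts.span_base)
  have "pure_tensor A B a b \<in> carr ?T" if ab: "a \<in> carr A" "b \<in> carr B" for a b
  proof -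
    obtain a0 a1 where a: "a0 \<in> part A 0" "a1 \<in> part A 1" "a = a0 + a1"
      using ab(1) by (auto simp: carr_def)
    obtain b0 b1 where b: "b0 \<in> part B 0" "b1 \<in> part B 1" "b = b0 + b1"
      using ab(2) by (auto simp: carr_def)
    note inA = subsetD[OF part_subset_carr[OF assms(1)]] and inB = subsetD[OF part_subset_carr[OF assms(2)]]
    have "pure_tensor A B a b =
        (pure_tensor A B a0 b0 + pure_tensor A B a0 b1) + (pure_tensor A B a1 b0 + pure_tensor A B a1 b1)"
      using bilinear_pure_tensor[of A B] a b ab inA inB unfolding bilinear_on_def by metis
    also have "\<dots> \<in> carr ?T"
      using a b by (intro ts.subspace_add[OF sub] hom)
    finally show ?thesis .
  qed
  then have "ts.span ?P \<subseteq> carr ?T"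
    by (intro ts.span_minimal[OF _ sub]) blast
  moreover have "carr ?T \<subseteq> ts.span ?P"
    unfolding carr_def[of ?T] using le by (blast intro: ts.span_add)
  ultimately show ?thesis by blast
qed

text \<open>The universal property: bilinear maps on \<open>A \<times> B\<close> factor uniquely through \<^const>\<open>pure_tensor\<close>.\<close>

theorem tensor_universal:
  fixes G :: "('x::ab_group_add) lie_super"
    and A :: "('x, 'a::ab_group_add) smodule" and B :: "('x, 'b::ab_group_add) smodule"
    and f :: "'a \<Rightarrow> 'b \<Rightarrow> 'w::ab_group_add"
  assumes A: "super_vector_space A" and B: "super_vector_space B" and W: "vector_space s"
    and f: "bilinear_on A B s f"
  defines "T \<equiv> carr (tensor_module G A B)"
  shows "\<exists>h. (\<forall>t\<in>T. \<forall>t'\<in>T. h (t + t') = h t + h t') \<and>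
             (\<forall>r. \<forall>t\<in>T. h (tensor_scale r t) = s r (h t)) \<and>
             (\<forall>a\<in>carr A. \<forall>b\<in>carr B. h (pure_tensor A B a b) = f a b)"
    and "\<lbrakk>\<forall>t\<in>T. \<forall>t'\<in>T. h (t + t') = h t + h t'; \<forall>r. \<forall>t\<in>T. h (tensor_scale r t) = s r (h t);
          \<forall>t\<in>T. \<forall>t'\<in>T. k (t + t') = k t + k t'; \<forall>r. \<forall>t\<in>T. k (tensor_scale r t) = s r (k t);
          \<forall>a\<in>carr A. \<forall>b\<in>carr B. h (pure_tensor A B a b) = f a b;
          \<forall>a\<in>carr A. \<forall>b\<in>carr B. k (pure_tensor A B a b) = f a b\<rbrakk>
         \<Longrightarrow> \<forall>t\<in>T. h t = (k t :: 'w)"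
proof -
  interpret W: vector_space s by fact
  interpret WC: vector_space_pair s "(*) :: complex \<Rightarrow> complex \<Rightarrow> complex"
    by unfold_locales (auto simp: algebra_simps)
  define P where "P = {pure_tensor A B a b | a b. a \<in> carr A \<and> b \<in> carr B}"
  have T: "T = ts.span P"
    unfolding T_def P_def by (rule carr_tensor[OF A B])
  define R where "R t w \<longleftrightarrow>
    (\<forall>\<phi>. Vector_Spaces.linear s (*) \<phi> \<longrightarrow> \<phi> w = t (\<lambda>a b. \<phi> (f a b)))" for t :: "('a, 'b) tensor" and w
  have R_unique: "w = w'" if "R t w" "R t w'" for t w w'
  proof (rule ccontr)
    assume "w \<noteq> w'"
    then have "W.independent {w - w'}" by simp
    from WC.linear_independent_extend[OF this, of "\<lambda>_. 1"]
    obtain \<phi> where \<phi>: "Vector_Spaces.linear s (*) \<phi>" "\<phi> (w - w') = 1" by auto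
    then have "\<phi> w = \<phi> w'" using that unfolding R_def by metis
    with \<phi> show False by (simp add: WC.linear_diff)
  qed
  have R_add: "R (t + t') (w + w')" if "R t w" "R t' w'" for t t' w w'
    using that by (simp add: R_def WC.linear_add)
  have R_scale: "R (tensor_scale r t) (s r w)" if "R t w" for r t w
    using that by (simp add: R_def WC.linear_scale tensor_scale_def)
  have R_pure: "R (pure_tensor A B a b) (f a b)" if "a \<in> carr A" "b \<in> carr B" for a b
  proof -
    have "bilinear_on A B (*) (\<lambda>a b. \<phi> (f a b))" if "Vector_Spaces.linear s (*) \<phi>" for \<phi>
      using f that unfolding bilinear_on_def by (simp add: WC.linear_add WC.linear_scale)
    then show ?thesis by (simp add: R_def pure_tensor_def)
  qed
  have R_ex: "\<exists>w. R t w" if "t \<in> T" for t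
    using that unfolding T
  proof (induction rule: ts.span_induct_alt)
    case base
    have "R 0 0" by (simp add: R_def WC.linear_0)
    then show ?case ..
  next
    case (step r t u)
    then show ?case using R_add R_scale R_pure unfolding P_def by blast
  qed
  define h where "h t = (THE w. R t w)" for t
  have h_eq: "h t = w" if "R t w" for t w
    unfolding h_def using that R_unique by blast
  show "\<exists>h. (\<forall>t\<in>T. \<forall>t'\<in>T. h (t + t') = h t + h t') \<and>
             (\<forall>r. \<forall>t\<in>T. h (tensor_scale r t) = s r (h t)) \<and>
             (\<forall>a\<in>carr A. \<forall>b\<in>carr B. h (pure_tensor A B a b) = f a b)"
  proof (intro exI[of _ h] conjI ballI allI)
    show "h (t + t') = h t + h t'" if "t \<in> T" "t' \<in> T" for t t'
      using R_ex[OF that(1)] R_ex[OF that(2)] R_add h_eq by metis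
    show "h (tensor_scale r t) = s r (h t)" if "t \<in> T" for r t
      using R_ex[OF that] R_scale h_eq by metis
    show "h (pure_tensor A B a b) = f a b" if "a \<in> carr A" "b \<in> carr B" for a b
      using R_pure[OF that] by (rule h_eq)
  qed
  fix h k :: "('a, 'b) tensor \<Rightarrow> 'w"
  assume h: "\<forall>t\<in>T. \<forall>t'\<in>T. h (t + t') = h t + h t'" "\<forall>r. \<forall>t\<in>T. h (tensor_scale r t) = s r (h t)"
    and k: "\<forall>t\<in>T. \<forall>t'\<in>T. k (t + t') = k t + k t'" "\<forall>r. \<forall>t\<in>T. k (tensor_scale r t) = s r (k t)"
    and hk: "\<forall>a\<in>carr A. \<forall>b\<in>carr B. h (pure_tensor A B a b) = f a b"
      "\<forall>a\<in>carr A. \<forall>b\<in>carr B. k (pure_tensor A B a b) = f a b"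
  show "\<forall>t\<in>T. h t = k t"
  proof
    fix t assume "t \<in> T"
    then have "t \<in> T \<and> h t = k t" unfolding T
    proof (induction rule: ts.span_induct_alt)
      case base
      have "0 \<in> T" by (simp add: T ts.span_zero)
      then have "h (tensor_scale 0 0) = s 0 (h 0)" "k (tensor_scale 0 0) = s 0 (k 0)"
        using h(2) k(2) by blast+
      then have "h 0 = k 0" by simp
      then show ?case using \<open>0 \<in> T\<close> unfolding T by blast
    next
      case (step r t u)
      then have "t \<in> T" "u \<in> T" "h u = k u" "h t = k t"
        using hk by (auto simp: T P_def intro!: ts.span_base)
      moreover from this have rt: "tensor_scale r t \<in> T" by (simp add: T ts.span_scale)
      ultimately have "h (tensor_scale r t + u) = k (tensor_scale r t + u)"
        using h k by metis
      moreover have "tensor_scale r t + u \<in> ts.span P"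
        using rt \<open>u \<in> T\<close> unfolding T by (rule ts.span_add)
      ultimately show ?case by blast
    qed
    then show "h t = k t" ..
  qed
qed

subsection \<open>The Fock space\<close>

lemma fock_psi_zero [simp]: "fock_psi n 0 = 0"
  by (simp add: fock_psi_def wedge_def d_xi_def basis_ext_def)

lemma fock_psi_eventually_zero: "\<exists>N. \<forall>n>N. fock_psi n v = 0"
proof -
  define K where "K = (\<Union>S\<in>Poly_Mapping.keys v. fset S)"
  have "finite K" by (simp add: K_def)
  then obtain N where N: "\<forall>n\<in>K. n \<le> N" using finite_nat_set_iff_bounded_le by blast
  have "fock_psi n v = 0" if "n > int N" for n
  proof -
    have "nat n |\<notin>| S" if "S \<in> Poly_Mapping.keys v" for S
      using that N \<open>n > int N\<close> by (fastforce simp: K_def)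
    then show ?thesis
      using that by (auto simp: fock_psi_def d_xi_def basis_ext_def intro!: sum.neutral)
  qed
  then show ?thesis by blast
qed

lemma finite_normal_ordered:
  "finite {j. fscale (of_int j) (normal_ordered (- j) (j + k) v) \<noteq> 0}"
proof -
  obtain N where N: "\<And>n. n > N \<Longrightarrow> fock_psi n v = 0" using fock_psi_eventually_zero by blast
  have "normal_ordered (- j) (j + k) v = 0" if "j \<notin> {- N..N - k}" for j
    using that N[of "j + k"] N[of "- j"] N by (force simp: normal_ordered_def)
  then have "{j. fscale (of_int j) (normal_ordered (- j) (j + k) v) \<noteq> 0} \<subseteq> {- N..N - k}"
    by force
  then show ?thesis by (rule finite_subset) simp
qed

end

theory Submission
  imports Defs
begin

text \<open>
  Fix \<open>r\<close> with \<open>r\<^sup>2 = \<lambda>\<close>.  The operators \<open>\<phi>\<^sub>n = \<psi>\<^sub>n / r\<close> make \<open>M\<close> a smooth Clifford module of level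
  \<open>1\<close>, so the normally ordered quadratic expressions defining the Virasoro action on the Fock
  space also make sense on \<open>M\<close> and give operators \<open>Lbar\<^sub>k\<close> satisfying the Virasoro relations with
  \<open>c = 1/2\<close> and having the same commutators with the \<open>\<phi>\<^sub>n\<close> as \<open>L\<^sub>k\<close>.  Hence \<open>L'\<^sub>k = L\<^sub>k - Lbar\<^sub>k\<close>
  commutes with all \<open>\<phi>\<^sub>n\<close> and satisfies the Virasoro relations with central charge \<open>c - 1/2\<close>.  It acts on
  the space \<open>V\<close> of even vectors killed by all \<open>\<phi>\<^sub>n\<close> with \<open>n > 0\<close>.  Applying creation operators to
  \<open>V\<close> gives an injective module map from \<open>Fock \<otimes> V\<close> to \<open>M\<close>, and any \<open>Vir\<close>-submodule \<open>U\<close> of \<open>V\<close> generates a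
  graded submodule of \<open>M\<close> whose even vacuum vectors are exactly \<open>U\<close>; so simplicity of \<open>M\<close> yields both
  surjectivity and simplicity of \<open>V\<close>.
\<close>

section \<open>Linear operators on a subspace\<close>

locale carrier_space = vector_space scale
  for scale :: "complex \<Rightarrow> 'v::ab_group_add \<Rightarrow> 'v" (infixr \<open>\<cdot>\<close> 75) +
  fixes S :: "'v set"
  assumes subspace_S: "subspace S"
begin

text \<open>Linearity is required on \<open>S\<close> only, because module operations are total
  functions whose values off the carrier are arbitrary.\<close>

definition endo :: "('v \<Rightarrow> 'v) \<Rightarrow> bool" where
  "endo f \<longleftrightarrow> (\<forall>v\<in>S. f v \<in> S) \<and> (\<forall>v\<in>S. \<forall>w\<in>S. f (v + w) = f v + f w)
     \<and> (\<forall>a. \<forall>v\<in>S. f (a \<cdot> v) = a \<cdot> f v)"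

lemmas S_closed [simp, intro] =
  subspace_0[OF subspace_S] subspace_add[OF subspace_S] subspace_scale[OF subspace_S]
  subspace_diff[OF subspace_S] subspace_neg[OF subspace_S] subspace_sum[OF subspace_S]

lemma endo_in: "endo f \<Longrightarrow> v \<in> S \<Longrightarrow> f v \<in> S"
  and endo_add: "endo f \<Longrightarrow> v \<in> S \<Longrightarrow> w \<in> S \<Longrightarrow> f (v + w) = f v + f w"
  and endo_scale: "endo f \<Longrightarrow> v \<in> S \<Longrightarrow> f (a \<cdot> v) = a \<cdot> f v"
  by (auto simp: endo_def)

lemma endo_zero: "endo f \<Longrightarrow> f 0 = 0"
  using endo_scale[of f 0 0] by simp

lemma endo_neg: "endo f \<Longrightarrow> v \<in> S \<Longrightarrow> f (- v) = - f v"
  using endo_scale[of f v "-1"] by simp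

lemma endo_diff: "endo f \<Longrightarrow> v \<in> S \<Longrightarrow> w \<in> S \<Longrightarrow> f (v - w) = f v - f w"
  using endo_add[of f v "- w"] endo_neg[of f w] by simp

lemma endo_sum: "endo f \<Longrightarrow> (\<And>i. i \<in> I \<Longrightarrow> g i \<in> S) \<Longrightarrow> f (\<Sum>i\<in>I. g i) = (\<Sum>i\<in>I. f (g i))"
  by (induction I rule: infinite_finite_induct) (auto simp: endo_zero endo_add)

lemmas endo_simps = endo_add endo_scale endo_neg endo_diff endo_sum

lemma Sum_any_in: "(\<And>i. g i \<in> S) \<Longrightarrow> Sum_any g \<in> S"
  by (simp add: Sum_any.expand_set)

lemma endo_Sum_any:
  assumes "endo f" "\<And>i. g i \<in> S" "finite {i. g i \<noteq> 0}"
  shows "f (Sum_any g) = Sum_any (\<lambda>i. f (g i))"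
proof -
  have "{i. f (g i) \<noteq> 0} \<subseteq> {i. g i \<noteq> 0}" using assms(1) by (auto simp: endo_zero[OF assms(1)])
  then show ?thesis
    using assms(2,3) by (simp add: Sum_any.expand_superset endo_sum[OF assms(1)])
qed

lemma scale_Sum_any:
  assumes "finite {i. g i \<noteq> 0}"
  shows "a \<cdot> Sum_any g = Sum_any (\<lambda>i. a \<cdot> g i)"
proof -
  have "Sum_any (\<lambda>i. a \<cdot> g i) = (\<Sum>i | g i \<noteq> 0. a \<cdot> g i)"
    by (rule Sum_any.expand_superset[OF assms]) auto
  then show ?thesis by (simp add: Sum_any.expand_set scale_sum_right)
qed

lemma endo_comp: "endo f \<Longrightarrow> endo g \<Longrightarrow> endo (\<lambda>v. f (g v))"
  by (simp add: endo_def)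

lemma endo_plus: "endo f \<Longrightarrow> endo g \<Longrightarrow> endo (\<lambda>v. f v + g v)"
  by (auto simp: endo_def algebra_simps)

lemma endo_minus: "endo f \<Longrightarrow> endo g \<Longrightarrow> endo (\<lambda>v. f v - g v)"
  by (auto simp: endo_def algebra_simps)

lemma endo_uminus: "endo f \<Longrightarrow> endo (\<lambda>v. - f v)"
  by (auto simp: endo_def algebra_simps)

lemma endo_smult: "endo f \<Longrightarrow> endo (\<lambda>v. a \<cdot> f v)"
  by (auto simp: endo_def algebra_simps)

lemma endo_id: "endo (\<lambda>v. v)" and endo_const_zero: "endo (\<lambda>v. 0)"
  by (auto simp: endo_def)

end


section \<open>The Virasoro action on a smooth Clifford module\<close>

locale clifford_rep = carrier_space scale S
  for scale :: "complex \<Rightarrow> 'v::ab_group_add \<Rightarrow> 'v" (infixr \<open>\<cdot>\<close> 75) and S :: "'v set" +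
  fixes \<phi> :: "int \<Rightarrow> 'v \<Rightarrow> 'v"
  assumes endo_phi: "endo (\<phi> n)"
    and clifford: "v \<in> S \<Longrightarrow> \<phi> m (\<phi> n v) + \<phi> n (\<phi> m v) = (if m + n = 0 then v else 0)"
    and phi_smooth: "v \<in> S \<Longrightarrow> \<exists>N. \<forall>n>N. \<phi> n v = 0"
begin

section \<open>Elementary consequences of the Clifford relations\<close>

lemma phi_in [simp]: "v \<in> S \<Longrightarrow> \<phi> n v \<in> S"
  using endo_phi endo_in by blast

lemma phi_zero [simp]: "\<phi> n 0 = 0"
  using endo_zero[OF endo_phi] .

lemmas phi_simps = endo_simps[OF endo_phi]

lemma phi_swap: "v \<in> S \<Longrightarrow> \<phi> m (\<phi> n v) = (if m + n = 0 then v else 0) - \<phi> n (\<phi> m v)"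
  using clifford[of v m n] by (simp add: algebra_simps)

lemma phi_anticommute: "v \<in> S \<Longrightarrow> m + n \<noteq> 0 \<Longrightarrow> \<phi> m (\<phi> n v) = - \<phi> n (\<phi> m v)"
  by (simp add: phi_swap[of v m n])

text \<open>The Clifford relation with equal indices determines only twice the square of an
  operator, so it has to be halved.\<close>

lemma double_eq_imp:
  fixes v w :: 'v
  assumes "v + v = w"
  shows "v = (1/2) \<cdot> w"
proof -
  have "v = (1/2 + 1/2) \<cdot> v" by simp
  also have "\<dots> = (1/2) \<cdot> (v + v)" by (simp only: scale_left_distrib scale_right_distrib)
  finally show ?thesis using assms by simp
qed

lemma phi_zero_squared: "v \<in> S \<Longrightarrow> \<phi> 0 (\<phi> 0 v) = (1/2) \<cdot> v"
  by (rule double_eq_imp) (use clifford[of v 0 0] in simp)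

lemma phi_squared: "v \<in> S \<Longrightarrow> n \<noteq> 0 \<Longrightarrow> \<phi> n (\<phi> n v) = 0"
  using double_eq_imp[of "\<phi> n (\<phi> n v)" 0] clifford[of v n n] by simp

text \<open>The ordering convention is that of \<open>normal_ordered\<close>, so that
  \<open>Lbar\<close> and \<open>fock_L\<close> can be compared term by term.\<close>

definition nord :: "int \<Rightarrow> int \<Rightarrow> 'v \<Rightarrow> 'v" where
  "nord j k v = (if k \<ge> j then \<phi> j (\<phi> k v) else - \<phi> k (\<phi> j v))"

definition Lbar :: "int \<Rightarrow> 'v \<Rightarrow> 'v" where
  "Lbar k v = (if k = 0 then 1 / 16 else 0) \<cdot> v
     + (1 / 2) \<cdot> Sum_any (\<lambda>j. of_int j \<cdot> nord (- j) (j + k) v)"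

lemma endo_nord: "endo (nord j k)"
proof -
  have "endo (\<lambda>v. \<phi> j (\<phi> k v))" "endo (\<lambda>v. - \<phi> k (\<phi> j v))"
    by (rule endo_comp[OF endo_phi endo_phi] endo_uminus[OF endo_comp[OF endo_phi endo_phi]])+
  then show ?thesis by (auto simp: nord_def[abs_def] endo_def)
qed

lemma nord_in [simp]: "v \<in> S \<Longrightarrow> nord j k v \<in> S"
  using endo_nord endo_in by blast

text \<open>The factors are exchanged exactly when \<open>j + k < - j\<close>. The exchange costs a
  scalar only for \<open>k = 0\<close>, and then the condition reads \<open>j < 0\<close>.\<close>

lemma nord_eq:
  "v \<in> S \<Longrightarrow> nord (- j) (j + k) v = \<phi> (- j) (\<phi> (j + k) v) - (if k = 0 \<and> j < 0 then v else 0)"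
  using phi_swap[of v "- j" "j + k"] by (auto simp: nord_def)

text \<open>The operator acting first has index \<open>max (- j) (j + k)\<close>, which exceeds the
  annihilation bound \<open>N\<close> for all but finitely many \<open>j\<close>.\<close>

lemma finite_nord_support: "v \<in> S \<Longrightarrow> finite {j. nord (- j) (j + k) v \<noteq> 0}"
proof -
  assume v: "v \<in> S"
  obtain N where N: "\<And>n. n > N \<Longrightarrow> \<phi> n v = 0" using phi_smooth[OF v] by blast
  have "nord (- j) (j + k) v = 0" if "j \<notin> {- N..N - k}" for j
    using that N[of "j + k"] N[of "- j"] by (force simp: nord_def)
  then have "{j. nord (- j) (j + k) v \<noteq> 0} \<subseteq> {- N..N - k}" by force
  then show ?thesis by (rule finite_subset) simp
qed

lemma finite_scaled_nord_support: "v \<in> S \<Longrightarrow> finite {j. f j \<cdot> nord (- j) (j + k) v \<noteq> 0}"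
  by (rule finite_subset[OF _ finite_nord_support[of v k]]) auto

lemma nord_sum_superset:
  assumes "v \<in> S" "finite I" "{j. nord (- j) (j + k) v \<noteq> 0} \<subseteq> I"
  shows "Sum_any (\<lambda>j. f j \<cdot> nord (- j) (j + k) v) = (\<Sum>j\<in>I. f j \<cdot> nord (- j) (j + k) v)"
  by (rule Sum_any.expand_superset) (use assms in auto)

lemma endo_Lbar: "endo (Lbar k)"
proof -
  let ?T = "\<lambda>v. Sum_any (\<lambda>j. of_int j \<cdot> nord (- j) (j + k) v)"
  have "?T (v + w) = ?T v + ?T w" if "v \<in> S" "w \<in> S" for v w
    using that Sum_any.distrib[OF finite_scaled_nord_support[of v of_int k] finite_scaled_nord_support[of w of_int k]]
    by (simp add: endo_add[OF endo_nord] scale_right_distrib)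
  moreover have "?T (a \<cdot> v) = a \<cdot> ?T v" if "v \<in> S" for a v
    using that scale_Sum_any[OF finite_scaled_nord_support[of v of_int k]]
    by (simp add: endo_scale[OF endo_nord] mult.commute)
  moreover have "?T v \<in> S" if "v \<in> S" for v
    using that by (intro Sum_any_in) simp
  ultimately have "endo ?T" unfolding endo_def by blast
  show ?thesis
    unfolding Lbar_def[abs_def] by (rule endo_plus[OF endo_smult[OF endo_id] endo_smult[OF \<open>endo ?T\<close>]])
qed

lemma Lbar_in [simp]: "v \<in> S \<Longrightarrow> Lbar k v \<in> S"
  using endo_Lbar endo_in by blast

text \<open>An operator commuting with all modes commutes with every quadratic expression in them.
  This will separate the two Virasoro actions on the module.\<close>

lemma Lbar_commute:
  assumes "endo T" "\<And>n v. v \<in> S \<Longrightarrow> T (\<phi> n v) = \<phi> n (T v)" "v \<in> S"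
  shows "T (Lbar k v) = Lbar k (T v)"
proof -
  have "T (nord j k v) = nord j k (T v)" for j k
    using assms(2,3) by (simp add: nord_def endo_neg[OF assms(1)])
  then show ?thesis
    using assms(3) endo_in[OF assms(1)] endo_Sum_any[OF assms(1) _ finite_scaled_nord_support[OF assms(3), of of_int k]]
    unfolding Lbar_def by (simp add: endo_simps[OF assms(1)] Sum_any_in)
qed

text \<open>The indices \<open>- j\<close> and \<open>j + k\<close> add up to \<open>k > 0\<close>,
  so the larger one, which belongs to the operator acting first, is positive.\<close>

lemma Lbar_vacuum:
  assumes "v \<in> S" "\<And>n. n > 0 \<Longrightarrow> \<phi> n v = 0" "k > 0"
  shows "Lbar k v = 0"
proof -
  have "nord (- j) (j + k) v = 0" for j
    using assms by (cases "j + k \<ge> - j") (auto simp: nord_def)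
  then show ?thesis using assms by (simp add: Lbar_def)
qed

lemma Lbar_superset:
  assumes "v \<in> S" "finite I" "{j. nord (- j) (j + k) v \<noteq> 0} \<subseteq> I"
  shows "Lbar k v = (if k = 0 then 1 / 16 else 0) \<cdot> v
     + (1 / 2) \<cdot> (\<Sum>j\<in>I. of_int j \<cdot> nord (- j) (j + k) v)"
  using nord_sum_superset[OF assms, of of_int] by (simp add: Lbar_def)

text \<open>Normal ordering changes the quadratic terms by scalars, which drop out of the
  commutator. Of the remaining commutators only those at \<open>j = n\<close> and
  \<open>j = - m - n\<close> can contribute, each a multiple of
  \<open>\<phi> (m + n)\<close>.\<close>

lemma Lbar_phi:
  assumes v: "v \<in> S"
  shows "Lbar m (\<phi> n v) - \<phi> n (Lbar m v) = (- of_int n - of_int m / 2) \<cdot> \<phi> (m + n) v"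
proof -
  \<comment> \<open>One finite index set serves both infinite sums and contains the two indices at
    which the commutator is concentrated.\<close>
  obtain I where I: "finite I" "{j. nord (- j) (j + m) v \<noteq> 0} \<subseteq> I"
      "{j. nord (- j) (j + m) (\<phi> n v) \<noteq> 0} \<subseteq> I" "n \<in> I" "- m - n \<in> I"
  proof -
    let ?I = "{j. nord (- j) (j + m) v \<noteq> 0} \<union> {j. nord (- j) (j + m) (\<phi> n v) \<noteq> 0} \<union> {n, - m - n}"
    have "finite ?I" using v by (simp add: finite_nord_support)
    then show ?thesis by (rule that) blast+
  qed
  define d where "d j = nord (- j) (j + m) (\<phi> n v) - \<phi> n (nord (- j) (j + m) v)" for j
  have d: "d j = (if j = - m - n then \<phi> (m + n) v else 0) - (if j = n then \<phi> (m + n) v else 0)" for j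
  proof -
    have "d j = \<phi> (- j) (\<phi> (j + m) (\<phi> n v)) - \<phi> n (\<phi> (- j) (\<phi> (j + m) v))"
      using v by (simp add: d_def nord_eq phi_simps)
    also have "\<dots> = \<phi> (- j) (if j + m + n = 0 then v else 0)
        - (if n - j = 0 then \<phi> (j + m) v else 0)"
      using v phi_swap[of v "j + m" n] phi_swap[of "\<phi> (j + m) v" "n" "- j"]
      by (simp add: phi_simps)
    also have "\<dots> = (if j = - m - n then \<phi> (m + n) v else 0) - (if j = n then \<phi> (m + n) v else 0)"
    proof -
      have "\<phi> (- j) (if j + m + n = 0 then v else 0) = (if j = - m - n then \<phi> (m + n) v else 0)"
      proof (cases "j = - m - n")
        case True
        then have "- j = m + n" by simp
        with True show ?thesis by simp
      qed auto
      moreover have "(if n - j = 0 then \<phi> (j + m) v else 0) = (if j = n then \<phi> (m + n) v else 0)"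
        by (auto simp: add.commute)
      ultimately show ?thesis by (simp only:)
    qed
    finally show ?thesis .
  qed
  have "Lbar m (\<phi> n v) - \<phi> n (Lbar m v) = (1/2) \<cdot> (\<Sum>j\<in>I. of_int j \<cdot> d j)"
    using v by (simp add: Lbar_superset[OF _ I(1,2)] Lbar_superset[OF _ I(1,3)] d_def
      phi_simps scale_right_diff_distrib sum_subtractf)
  also have "(\<Sum>j\<in>I. of_int j \<cdot> d j) = (\<Sum>j\<in>I. if j = - m - n then of_int j \<cdot> \<phi> (m + n) v else 0)
      - (\<Sum>j\<in>I. if j = n then of_int j \<cdot> \<phi> (m + n) v else 0)"
    unfolding d sum_subtractf[symmetric] by (intro sum.cong) auto
  also have "\<dots> = of_int (- m - n) \<cdot> \<phi> (m + n) v - of_int n \<cdot> \<phi> (m + n) v"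
    using I by (simp add: sum.delta)
  also have "(1/2) \<cdot> \<dots> = (- of_int n - of_int m / 2) \<cdot> \<phi> (m + n) v"
  proof -
    have "1/2 * (of_int (- m - n) - of_int n) = - of_int n - (of_int m / 2 :: complex)"
      by (simp add: field_simps)
    then show ?thesis by (simp only: scale_left_diff_distrib[symmetric] scale_scale)
  qed
  finally show ?thesis .
qed

text \<open>The involution \<open>j \<mapsto> - j - k\<close> swaps the two indices, and normally
  ordered products are antisymmetric off the diagonal. On the diagonal the square vanishes unless
  the mode is \<open>\<phi> 0\<close>, whose square is \<open>1/2\<close>.\<close>

lemma Sum_nord:
  assumes v: "v \<in> S"
  shows "Sum_any (\<lambda>j. nord (- j) (j + k) v) = (if k = 0 then 1/2 else 0) \<cdot> v"
proof -
  define N where "N j = nord (- j) (j + k) v" for j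
  have fin: "finite {j. N j \<noteq> 0}" unfolding N_def by (rule finite_nord_support[OF v])
  have bij: "bij (\<lambda>j. - j - k)"
    by (rule bij_betw_byWitness[where f' = "\<lambda>j. - j - k"]) auto
  have anti: "N j + N (- j - k) = (if j = 0 then (if k = 0 then v else 0) else 0)" for j
  proof -
    have "N (- j - k) = nord (j + k) (- j) v" by (simp add: N_def algebra_simps)
    moreover have "v + v = 2 \<cdot> v" using scale_left_distrib[of 1 1 v] by simp
    moreover have "nord (- j) (j + k) v + nord (j + k) (- j) v
        = (if j = 0 then (if k = 0 then v else 0) else 0)"
    proof (cases "j + k = - j")
      case True
      then have "j = 0 \<longleftrightarrow> k = 0" by auto
      then show ?thesis
        using v \<open>v + v = 2 \<cdot> v\<close>
        by (auto simp: True nord_def phi_zero_squared phi_squared scale_right_distrib[symmetric])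
    next
      case False
      then show ?thesis by (simp add: nord_def)
    qed
    ultimately show ?thesis by (simp add: N_def)
  qed
  have fin': "finite {j. N (- j - k) \<noteq> 0}"
  proof (rule finite_subset)
    show "{j. N (- j - k) \<noteq> 0} \<subseteq> (\<lambda>j. - j - k) ` {j. N j \<noteq> 0}"
    proof
      fix j assume "j \<in> {j. N (- j - k) \<noteq> 0}"
      then show "j \<in> (\<lambda>j. - j - k) ` {j. N j \<noteq> 0}" by (intro image_eqI[of _ _ "- j - k"]) auto
    qed
  qed (use fin in simp)
  have "Sum_any N + Sum_any N = Sum_any N + Sum_any (\<lambda>j. N (- j - k))"
    using Sum_any.reindex_cong[OF bij, of N "\<lambda>j. N (- j - k)"] by (simp add: o_def)
  also have "\<dots> = (if k = 0 then v else 0)"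
    unfolding Sum_any.distrib[OF fin fin', symmetric] anti by simp
  finally show ?thesis using double_eq_imp[of "Sum_any N"] unfolding N_def by auto
qed

end

section \<open>Telescoping sums over intervals of integers\<close>

lemma sum_telescope_int:
  fixes F :: "int \<Rightarrow> complex"
  assumes "a \<le> b"
  shows "(\<Sum>j\<in>{a..<b}. F (j + 1) - F j) = F b - F a"
  using assms
proof (induction b rule: int_ge_induct)
  case (step i)
  then have "{a..<i + 1} = insert i {a..<i}" by auto
  with step show ?case by simp
qed simp

text \<open>The second factor is the signed indicator of the interval between \<open>0\<close> and
  \<open>m\<close>: it is \<open>1\<close> on \<open>{0..<m}\<close> and \<open>- 1\<close> on
  \<open>{m..<0}\<close>, so both signs of \<open>m\<close> give the same boundary terms.\<close>

lemma sum_between_telescope: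
  fixes F :: "int \<Rightarrow> complex"
  assumes "finite I" "{- \<bar>m\<bar>..\<bar>m\<bar>} \<subseteq> I"
  shows "(\<Sum>j\<in>I. (F (j + 1) - F j) * ((if j < m then 1 else 0) - (if j < 0 then 1 else 0))) = F m - F 0"
proof (cases "m \<ge> 0")
  case True
  have "(\<Sum>j\<in>I. (F (j + 1) - F j) * ((if j < m then 1 else 0) - (if j < 0 then 1 else 0)))
      = (\<Sum>j\<in>{0..<m}. F (j + 1) - F j)"
    by (rule sum.mono_neutral_cong_right) (use assms True in auto)
  then show ?thesis using sum_telescope_int[OF True] by simp
next
  case False
  have "(\<Sum>j\<in>I. (F (j + 1) - F j) * ((if j < m then 1 else 0) - (if j < 0 then 1 else 0)))
      = (\<Sum>j\<in>{m..<0}. - (F (j + 1) - F j))"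
    by (rule sum.mono_neutral_cong_right) (use assms False in auto)
  then show ?thesis using sum_telescope_int[of m 0 F] False by (simp only: sum_negf) simp
qed

section \<open>The Virasoro relations with central charge 1/2\<close>

context clifford_rep
begin

text \<open>For \<open>m + n = 0\<close> the two halves of the commutator are not separately finite sums; the central
  term is what remains after each has been normally ordered.\<close>

lemma Lbar_bracket:
  assumes v: "v \<in> S"
  shows "Lbar m (Lbar n v) - Lbar n (Lbar m v) = of_int (m - n) \<cdot> Lbar (m + n) v
    + (if m = - n then (of_int m ^ 3 - of_int m) / 24 else 0) \<cdot> v"
proof -
  define N where "N j = nord (- j) (j + (m + n)) v" for j
  have fin_N: "finite {j. N j \<noteq> 0}" unfolding N_def using v by (rule finite_nord_support)
  \<comment> \<open>Only \<open>Lbar n\<close> is expanded into its quadratic terms;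
    \<open>Lbar m\<close> enters through its commutators with the modes.\<close>
  define d where "d j = Lbar m (nord (- j) (j + n) v) - nord (- j) (j + n) (Lbar m v)" for j
  let ?f = "\<lambda>j::int. of_int j * (of_int j - of_int m / 2) :: complex"
  let ?g = "\<lambda>j::int. of_int j * (of_int j + of_int n + of_int m / 2) :: complex"
  let ?\<chi> = "\<lambda>j::int. (if j < m then 1 else 0) - (if j < 0 then 1 else 0) :: complex"
  obtain I where I: "finite I" "{j. nord (- j) (j + n) v \<noteq> 0} \<subseteq> I"
      "{j. nord (- j) (j + n) (Lbar m v) \<noteq> 0} \<subseteq> I" "{j. N j \<noteq> 0} \<subseteq> I" "{j. N (j - m) \<noteq> 0} \<subseteq> I"
      "{- \<bar>m\<bar>..\<bar>m\<bar>} \<subseteq> I"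
  proof -
    let ?I = "{j. nord (- j) (j + n) v \<noteq> 0} \<union> {j. nord (- j) (j + n) (Lbar m v) \<noteq> 0}
      \<union> {j. N j \<noteq> 0} \<union> (\<lambda>j. j + m) ` {j. N j \<noteq> 0} \<union> {- \<bar>m\<bar>..\<bar>m\<bar>}"
    have "finite ?I" using v fin_N by (simp add: finite_nord_support)
    moreover have "{j. N (j - m) \<noteq> 0} \<subseteq> (\<lambda>j. j + m) ` {j. N j \<noteq> 0}"
    proof
      fix j assume "j \<in> {j. N (j - m) \<noteq> 0}"
      then show "j \<in> (\<lambda>j. j + m) ` {j. N j \<noteq> 0}" by (intro image_eqI[of _ _ "j - m"]) auto
    qed
    ultimately show ?thesis by (intro that[of ?I]) blast+
  qed
  have L_phi: "Lbar m (\<phi> a w) = \<phi> a (Lbar m w) + (- of_int a - of_int m / 2) \<cdot> \<phi> (m + a) w"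
    if "w \<in> S" for a w
    using Lbar_phi[OF that, of m a] by (simp add: algebra_simps)
  \<comment> \<open>Normal ordering the two resulting products produces scalars for
    \<open>j < m\<close> and for \<open>j < 0\<close>. When \<open>n = - m\<close> their
    coefficients agree, so only the finitely supported difference \<open>?\<chi>\<close>
    survives.\<close>
  have d: "d j = (of_int j - of_int m / 2) \<cdot> N (j - m) - (of_int j + of_int n + of_int m / 2) \<cdot> N j
     + (if m + n = 0 then ((of_int j - of_int m / 2) * ?\<chi> j) \<cdot> v else 0)" for j
  proof -
    let ?B = "\<lambda>i. \<phi> (- i) (\<phi> (i + (m + n)) v)"
    have "d j = Lbar m (\<phi> (- j) (\<phi> (j + n) v)) - \<phi> (- j) (\<phi> (j + n) (Lbar m v))"
      using v by (auto simp: d_def nord_eq endo_diff[OF endo_Lbar] endo_zero[OF endo_Lbar])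
    also have "\<dots> = (of_int j - of_int m / 2) \<cdot> ?B (j - m) + (- of_int (j + n) - of_int m / 2) \<cdot> ?B j"
      using v by (simp add: L_phi phi_simps algebra_simps)
    also have "- of_int (j + n) - of_int m / 2 = - (of_int j + of_int n + of_int m / 2 :: complex)"
      by simp
    finally have "d j = (of_int j - of_int m / 2) \<cdot> ?B (j - m) - (of_int j + of_int n + of_int m / 2) \<cdot> ?B j"
      by (simp only: scale_minus_left diff_conv_add_uminus)
    moreover have B: "?B i = N i + (if m + n = 0 \<and> i < 0 then v else 0)" for i
      using v by (simp add: N_def nord_eq)
    ultimately have e: "d j = (of_int j - of_int m / 2) \<cdot> (N (j - m) + (if m + n = 0 \<and> j - m < 0 then v else 0))
        - (of_int j + of_int n + of_int m / 2) \<cdot> (N j + (if m + n = 0 \<and> j < 0 then v else 0))"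
      by (simp only: B)
    show ?thesis
    proof (cases "m + n = 0")
      case True
      then have "n = - m" by simp
      then have c: "of_int j + of_int n + of_int m / 2 = (of_int j - of_int m / 2 :: complex)" by simp
      show ?thesis unfolding e c using True
        by (cases "j < 0"; cases "j < m") (simp_all add: scale_right_distrib flip: scale_minus_left)
    next
      case False
      then show ?thesis unfolding e by simp
    qed
  qed
  have "(\<Sum>j\<in>I. of_int j \<cdot> d j) = (\<Sum>j\<in>I. ?f j \<cdot> N (j - m)) - (\<Sum>j\<in>I. ?g j \<cdot> N j)
     + (if m + n = 0 then (\<Sum>j\<in>I. ?f j * ?\<chi> j) \<cdot> v else 0)"
    unfolding d by (simp add: scale_right_distrib scale_right_diff_distrib sum.distrib sum_subtractf
      scale_sum_left mult.assoc)
  \<comment> \<open>The shift of the index is legitimate on \<open>Sum_any\<close>; \<open>I\<close>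
    was chosen to contain the support before and after it.\<close>
  also have "(\<Sum>j\<in>I. ?f j \<cdot> N (j - m)) = (\<Sum>j\<in>I. ?f (j + m) \<cdot> N j)"
  proof -
    have "bij (\<lambda>j. j + m)" by (rule bij_betw_byWitness[where f' = "\<lambda>j. j - m"]) auto
    then have "Sum_any (\<lambda>j. ?f j \<cdot> N (j - m)) = Sum_any (\<lambda>j. ?f (j + m) \<cdot> N j)"
      by (rule Sum_any.reindex_cong) (simp add: fun_eq_iff)
    moreover have "Sum_any (\<lambda>j. ?f j \<cdot> N (j - m)) = (\<Sum>j\<in>I. ?f j \<cdot> N (j - m))"
      by (rule Sum_any.expand_superset) (use I in auto)
    moreover have "Sum_any (\<lambda>j. ?f (j + m) \<cdot> N j) = (\<Sum>j\<in>I. ?f (j + m) \<cdot> N j)"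
      by (rule Sum_any.expand_superset) (use I in auto)
    ultimately show ?thesis by simp
  qed
  also have "\<dots> - (\<Sum>j\<in>I. ?g j \<cdot> N j) = (\<Sum>j\<in>I. (?f (j + m) - ?g j) \<cdot> N j)"
    by (simp add: sum_subtractf scale_left_diff_distrib)
  \<comment> \<open>The quadratic terms in \<open>j\<close> cancel. The linear part rebuilds
    \<open>Lbar (m + n)\<close>, and the constant part is evaluated by
    \<open>Sum_nord\<close>.\<close>
  also have "\<dots> = (\<Sum>j\<in>I. of_int (m - n) \<cdot> (of_int j \<cdot> N j) + (of_int m ^ 2 / 2) \<cdot> N j)"
  proof (rule sum.cong[OF refl])
    fix j
    have "?f (j + m) - ?g j = of_int (m - n) * of_int j + of_int m ^ 2 / 2"
      by (simp add: field_simps power2_eq_square)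
    then show "(?f (j + m) - ?g j) \<cdot> N j = of_int (m - n) \<cdot> (of_int j \<cdot> N j) + (of_int m ^ 2 / 2) \<cdot> N j"
      by (simp only: scale_left_distrib scale_scale)
  qed
  also have "\<dots> = of_int (m - n) \<cdot> (\<Sum>j\<in>I. of_int j \<cdot> N j) + (of_int m ^ 2 / 2) \<cdot> (\<Sum>j\<in>I. N j)"
    by (simp only: sum.distrib scale_sum_right)
  also have "(\<Sum>j\<in>I. N j) = (if m + n = 0 then 1/2 else 0) \<cdot> v"
    using Sum_nord[OF v, of "m + n"] Sum_any.expand_superset[OF I(1,4)] by (simp add: N_def)
  also have "(\<Sum>j\<in>I. ?f j * ?\<chi> j) = of_int m * (of_int m - 1) * (of_int m - 2) / 12"
  proof -
    \<comment> \<open>A discrete antiderivative of \<open>?f\<close>, assembled from the closed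
      forms for sums of squares and of consecutive integers.\<close>
    define F :: "int \<Rightarrow> complex" where
      "F x = (of_int x - 1) * of_int x * (2 * of_int x - 1) / 6 - of_int m / 4 * of_int x * (of_int x - 1)" for x
    have "?f j = F (j + 1) - F j" for j
      by (simp add: F_def field_simps)
    then have "(\<Sum>j\<in>I. ?f j * ?\<chi> j) = (\<Sum>j\<in>I. (F (j + 1) - F j) * ?\<chi> j)" by simp
    also have "\<dots> = F m - F 0" by (rule sum_between_telescope[OF I(1,6)])
    also have "\<dots> = of_int m * (of_int m - 1) * (of_int m - 2) / 12" by (simp add: F_def field_simps)
    finally show ?thesis .
  qed
  finally have sum_d: "(\<Sum>j\<in>I. of_int j \<cdot> d j) = of_int (m - n) \<cdot> (\<Sum>j\<in>I. of_int j \<cdot> N j)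
     + (of_int m ^ 2 / 2) \<cdot> ((if m + n = 0 then 1/2 else 0) \<cdot> v)
     + (if m + n = 0 then (of_int m * (of_int m - 1) * (of_int m - 2) / 12) \<cdot> v else 0)" .
  have "Lbar m (Lbar n v) - Lbar n (Lbar m v) = (1/2) \<cdot> (\<Sum>j\<in>I. of_int j \<cdot> d j)"
    using v by (simp add: Lbar_superset[OF _ I(1,2)] Lbar_superset[OF _ I(1,3)] d_def
      endo_simps[OF endo_Lbar] scale_right_diff_distrib sum_subtractf)
  moreover have "Lbar (m + n) v = (if m + n = 0 then 1 / 16 else 0) \<cdot> v + (1/2) \<cdot> (\<Sum>j\<in>I. of_int j \<cdot> N j)"
    using Lbar_superset[OF v I(1), of "m + n"] I(4) by (simp add: N_def)
  moreover define \<Sigma> where "\<Sigma> = (\<Sum>j\<in>I. of_int j \<cdot> N j)"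
  ultimately have L: "Lbar m (Lbar n v) - Lbar n (Lbar m v) = (1/2) \<cdot> (of_int (m - n) \<cdot> \<Sigma>
     + (of_int m ^ 2 / 2) \<cdot> ((if m + n = 0 then 1/2 else 0) \<cdot> v)
     + (if m + n = 0 then (of_int m * (of_int m - 1) * (of_int m - 2) / 12) \<cdot> v else 0))"
    and R: "Lbar (m + n) v = (if m + n = 0 then 1 / 16 else 0) \<cdot> v + (1/2) \<cdot> \<Sigma>"
    by (simp_all only: sum_d)
  show ?thesis
  proof (cases "m + n = 0")
    case False
    then have "m \<noteq> - n" by auto
    then show ?thesis unfolding L R using False by (simp add: mult.commute)
  next
    case True
    then have n: "n = - m" by auto
    let ?m = "of_int m :: complex"
    \<comment> \<open>The left side equals \<open>m^3/24 + m/12\<close>. The constant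
      \<open>1/16\<close> in \<open>Lbar 0\<close> accounts for \<open>m/8\<close> of it, and what
      is left is the central term for central charge \<open>1/2\<close>.\<close>
    have c: "1/2 * (?m^2/2 * (1/2)) + 1/2 * (?m * (?m - 1) * (?m - 2) / 12) = 2 * ?m * (1/16) + (?m^3 - ?m) / 24"
      by (simp add: field_simps power2_eq_square power3_eq_cube)
    have "Lbar m (Lbar n v) - Lbar n (Lbar m v) = (1/2 * (2 * ?m)) \<cdot> \<Sigma>
      + (1/2 * (?m^2/2 * (1/2)) + 1/2 * (?m * (?m - 1) * (?m - 2) / 12)) \<cdot> v"
      unfolding L unfolding n by (simp only: scale_right_distrib scale_left_distrib scale_scale add.assoc) simp
    also have "\<dots> = of_int (m - n) \<cdot> Lbar (m + n) v
    + (if m = - n then (of_int m ^ 3 - of_int m) / 24 else 0) \<cdot> v"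
      unfolding R c unfolding n by (simp add: scale_right_distrib scale_left_distrib)
    finally show ?thesis .
  qed
qed

end

section \<open>Monomials in the creation operators\<close>

lemma wedge_add: "wedge x (y + y') = wedge x y + wedge x y'"
  and wedge_scale: "wedge x (fscale a y) = fscale a (wedge x y)"
  by (simp_all only: wedge_def basis_ext_add[OF vector_space_fscale] basis_ext_scale[OF vector_space_fscale]
      basis_ext_fun_add[OF vector_space_fscale] basis_ext_fun_scale[OF vector_space_fscale])

lemma fock_psi_add: "fock_psi n (x + y) = fock_psi n x + fock_psi n y"
  and fock_psi_scale: "fock_psi n (fscale a x) = fscale a (fock_psi n x)"
  by (simp_all add: fock_psi_def wedge_add wedge_scale d_xi_def basis_ext_add[OF vector_space_fscale]
      basis_ext_scale[OF vector_space_fscale] fs.scale_right_distrib mult.commute)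

text \<open>The sign for moving a generator of index \<open>n\<close> to its place in the increasing
  product over \<open>A\<close>. The same exponent occurs in \<open>d_xi\<close> and, for a single
  left factor, in \<open>wedge_basis\<close>.\<close>

definition left_sign :: "nat \<Rightarrow> nat set \<Rightarrow> complex" where
  "left_sign n A = (- 1) ^ card {a \<in> A. a < n}"

lemma left_sign_squared: "left_sign n A * left_sign n A = 1"
  by (simp add: left_sign_def flip: power_add mult_2)

lemma left_sign_nonzero: "left_sign n A \<noteq> 0"
  by (simp add: left_sign_def)

lemma left_sign_zero: "left_sign 0 A = 1"
  by (simp add: left_sign_def)

lemma left_sign_remove: "left_sign n (A - {n}) = left_sign n A"
proof -
  have "{a \<in> A - {n}. a < n} = {a \<in> A. a < n}" by auto
  then show ?thesis by (simp only: left_sign_def)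
qed

lemma left_sign_insert: "finite A \<Longrightarrow> x < n \<Longrightarrow> x \<notin> A \<Longrightarrow> left_sign n (insert x A) = - left_sign n A"
proof -
  assume *: "finite A" "x < n" "x \<notin> A"
  then have "{a \<in> insert x A. a < n} = insert x {a \<in> A. a < n}" by auto
  then show ?thesis using * by (simp add: left_sign_def)
qed

lemma left_sign_below: "(\<And>a. a \<in> A \<Longrightarrow> n \<le> a) \<Longrightarrow> left_sign n A = 1"
proof -
  assume "\<And>a. a \<in> A \<Longrightarrow> n \<le> a"
  then have "{a \<in> A. a < n} = {}" by force
  then show ?thesis by (simp only: left_sign_def) simp
qed

lemma d_xi_basis:
  "d_xi n (bv T) = (if n |\<in>| T then fscale (left_sign n (fset T)) (bv (T |-| {|n|})) else 0)"
  by (simp add: d_xi_def basis_ext_single[OF vector_space_fscale] left_sign_def)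

lemma wedge_xi_basis:
  "wedge (xi n) (bv T) = (if n |\<in>| T then 0 else fscale (left_sign n (fset T)) (bv (finsert n T)))"
proof -
  have "{(s, t). s |\<in>| {|n|} \<and> t |\<in>| T \<and> t < s} = Pair n ` {t \<in> fset T. t < n}" by auto
  then have "card {(s, t). s |\<in>| {|n|} \<and> t |\<in>| T \<and> t < s} = card {t \<in> fset T. t < n}"
    by (simp add: card_image inj_on_def)
  then show ?thesis
    by (auto simp: wedge_def xi_def basis_ext_single[OF vector_space_fscale] wedge_basis_def left_sign_def)
qed

section \<open>Vacuum vectors and the creation operators applied to them\<close>

context clifford_rep
begin

definition vac :: "'v set" where
  "vac = {v \<in> S. \<forall>n>0. \<phi> n v = 0}"

lemma subspace_vac: "subspace vac"
  by (rule subspaceI) (simp_all add: vac_def phi_simps)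

lemma vacI: "v \<in> S \<Longrightarrow> (\<And>n. n > 0 \<Longrightarrow> \<phi> n v = 0) \<Longrightarrow> v \<in> vac"
  and vac_in [simp]: "v \<in> vac \<Longrightarrow> v \<in> S"
  and phi_vac: "v \<in> vac \<Longrightarrow> n > 0 \<Longrightarrow> \<phi> n v = 0"
  by (simp_all add: vac_def)

text \<open>Multiplication by \<open>\<xi>\<^sub>n\<close> on the Fock space; for \<open>n = 0\<close> the operator
  \<open>\<xi>\<^sub>0 + \<partial>/\<partial>\<xi>\<^sub>0\<close> takes its place.\<close>

definition crea :: "nat \<Rightarrow> 'v \<Rightarrow> 'v" where
  "crea n v = (if n = 0 then of_real (sqrt 2) \<cdot> \<phi> 0 v else \<phi> (- int n) v)"

lemma endo_crea: "endo (crea n)"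
  using endo_phi endo_smult[OF endo_phi] by (cases "n = 0") (simp_all add: crea_def[abs_def])

lemma crea_in [simp]: "v \<in> S \<Longrightarrow> crea n v \<in> S"
  by (simp add: crea_def)

lemmas crea_simps = endo_simps[OF endo_crea] endo_zero[OF endo_crea]

lemma crea_anticommute: "v \<in> S \<Longrightarrow> m \<noteq> n \<Longrightarrow> crea m (crea n v) = - crea n (crea m v)"
  using phi_anticommute[of v "- int m" "- int n"] by (auto simp: crea_def phi_simps)

lemma of_real_sqrt_2_mult: "of_real (sqrt 2) * of_real (sqrt 2) = (2::complex)"
  by (simp flip: of_real_mult)

text \<open>The factor \<open>sqrt 2\<close> makes \<open>crea 0\<close> an involution, just as the
  operator \<xi>_0 + d/d\<xi>_0 squares to the identity.\<close>

lemma crea_twice: "v \<in> S \<Longrightarrow> crea n (crea n v) = (if n = 0 then v else 0)"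
  by (simp add: crea_def phi_simps phi_zero_squared phi_squared of_real_sqrt_2_mult)

lemma phi_crea:
  "v \<in> S \<Longrightarrow> n > 0 \<Longrightarrow> \<phi> (int n) (crea k v) = (if k = n then v else 0) - crea k (\<phi> (int n) v)"
  using phi_swap[of v "int n" "- int k"] by (auto simp: crea_def phi_simps)

text \<open>The least index is applied last and so stands leftmost, which matches the increasing
  wedge products of the Fock basis.\<close>

definition mono :: "nat set \<Rightarrow> 'v \<Rightarrow> 'v" where
  "mono A v = foldr crea (sorted_list_of_set A) v"

lemma endo_foldr_crea: "endo (foldr crea xs)"
proof (induction xs)
  case Nil
  then show ?case using endo_id by (simp add: id_def)
next
  case (Cons x xs)
  then show ?case using endo_comp[OF endo_crea Cons] by (simp add: o_def)
qed

lemma endo_mono: "endo (mono A)"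
  unfolding mono_def[abs_def] by (rule endo_foldr_crea)

lemma foldr_crea_in [simp]: "v \<in> S \<Longrightarrow> foldr crea xs v \<in> S"
  by (rule endo_in[OF endo_foldr_crea])

lemma mono_in [simp]: "v \<in> S \<Longrightarrow> mono A v \<in> S"
  by (simp add: mono_def)

text \<open>The new factor anticommutes past each smaller index at the cost of one sign.\<close>

lemma crea_foldr_insort:
  assumes "v \<in> S" "sorted xs" "distinct xs" "n \<notin> set xs"
  shows "crea n (foldr crea xs v) = left_sign n (set xs) \<cdot> foldr crea (insort n xs) v"
  using assms(2-)
proof (induction xs)
  case Nil
  then show ?case by (simp add: left_sign_def)
next
  case (Cons x xs)
  show ?case
  proof (cases "n \<le> x")
    case True
    then have "left_sign n (set (x # xs)) = 1"
      using Cons.prems by (intro left_sign_below) auto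
    then show ?thesis using True by simp
  next
    case False
    then have "crea n (crea x (foldr crea xs v)) = - crea x (crea n (foldr crea xs v))"
      using assms(1) by (intro crea_anticommute) auto
    then show ?thesis
      using False Cons assms(1) by (simp add: left_sign_insert crea_simps)
  qed
qed

text \<open>The annihilator anticommutes past every factor except the one of its own index, which it
  contracts away. If it reaches the vacuum vector, it kills it.\<close>

lemma phi_foldr_crea:
  assumes "v \<in> vac" "sorted xs" "distinct xs" "n > 0"
  shows "\<phi> (int n) (foldr crea xs v) =
    (if n \<in> set xs then left_sign n (set xs) \<cdot> foldr crea (remove1 n xs) v else 0)"
  using assms(2,3)
proof (induction xs)
  case Nil
  then show ?case using assms by (simp add: phi_vac)
next
  case (Cons x xs)
  have *: "\<phi> (int n) (crea x (foldr crea xs v))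
      = (if x = n then foldr crea xs v else 0) - crea x (\<phi> (int n) (foldr crea xs v))"
    using assms by (intro phi_crea) auto
  show ?case
  proof (cases "x = n")
    case True
    have "left_sign n (set (n # xs)) = 1"
      using Cons.prems True by (intro left_sign_below) auto
    with True * Cons show ?thesis by (simp add: crea_simps)
  next
    case False
    then have "n \<in> set xs \<Longrightarrow> x < n" using Cons.prems by auto
    with False * Cons assms(1) show ?thesis by (simp add: crea_simps left_sign_insert)
  qed
qed

lemma crea_mono:
  assumes "finite A" "v \<in> S" "n \<notin> A"
  shows "crea n (mono A v) = left_sign n A \<cdot> mono (insert n A) v"
  using crea_foldr_insort[of v "sorted_list_of_set A" n] assms
  by (simp add: mono_def sorted_list_of_set_insert_remove)

lemma mono_eq_crea:
  assumes "finite A" "v \<in> S" "n \<in> A"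
  shows "mono A v = left_sign n A \<cdot> crea n (mono (A - {n}) v)"
  using crea_mono[of "A - {n}" v n] assms
  by (simp add: left_sign_remove left_sign_squared insert_absorb)

text \<open>A repeated creation operator gives zero, except that \<open>crea 0\<close> cancels
  itself. The exception is the contribution of the derivative in the action of the zero
  mode.\<close>

lemma crea_mono_mem:
  assumes "finite A" "v \<in> S" "n \<in> A"
  shows "crea n (mono A v) = (if n = 0 then mono (A - {0}) v else 0)"
  unfolding mono_eq_crea[OF assms] using assms
  by (simp add: crea_simps crea_twice left_sign_zero)

lemma phi_mono:
  assumes "finite A" "v \<in> vac" "n > 0"
  shows "\<phi> (int n) (mono A v) = (if n \<in> A then left_sign n A \<cdot> mono (A - {n}) v else 0)"
  using phi_foldr_crea[of v "sorted_list_of_set A" n] assms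
  by (simp add: mono_def sorted_list_of_set_remove)

lemma mono_empty [simp]: "mono {} v = v"
  by (simp add: mono_def)

lemma mono_commute:
  assumes "endo T" "\<And>n v. v \<in> S \<Longrightarrow> T (\<phi> n v) = \<phi> n (T v)" "v \<in> S"
  shows "T (mono A v) = mono A (T v)"
proof -
  have "T (crea n w) = crea n (T w)" if "w \<in> S" for n w
    using assms(2) that by (simp add: crea_def endo_scale[OF assms(1)])
  then have "T (foldr crea xs v) = foldr crea xs (T v)" for xs
    using assms(3) by (induction xs) auto
  then show ?thesis by (simp add: mono_def)
qed

text \<open>Reads \<open>x\<close> as a polynomial in the creation operators and applies it to
  \<open>v\<close>. Restricted to even vacuum vectors, this bilinear map will induce the isomorphism
  from the tensor product.\<close>

definition fock_map :: "ext \<Rightarrow> 'v \<Rightarrow> 'v" where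
  "fock_map x v = basis_ext scale (\<lambda>A. mono (fset A) v) x"

lemma fock_map_basis [simp]: "fock_map (bv A) v = mono (fset A) v"
  unfolding fock_map_def by (rule basis_ext_single[OF vector_space_axioms])

lemma fock_map_add_left: "fock_map (x + y) v = fock_map x v + fock_map y v"
  and fock_map_scale_left: "fock_map (fscale a x) v = a \<cdot> fock_map x v"
  and fock_map_zero_left [simp]: "fock_map 0 v = 0"
  by (simp_all add: fock_map_def basis_ext_add[OF vector_space_axioms] basis_ext_scale[OF vector_space_axioms])

lemma fock_map_neg_left: "fock_map (- x) v = - fock_map x v"
  using fock_map_add_left[of x "- x" v] by (simp add: eq_neg_iff_add_eq_0 add.commute)

lemma fock_map_sum_left: "fock_map (\<Sum>i\<in>I. f i) v = (\<Sum>i\<in>I. fock_map (f i) v)"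
  by (induction I rule: infinite_finite_induct) (simp_all add: fock_map_add_left)

lemmas fock_map_left = fock_map_add_left fock_map_scale_left fock_map_neg_left fock_map_sum_left

lemma endo_fock_map: "endo (fock_map x)"
proof -
  have "fock_map x v \<in> S" if "v \<in> S" for v
    using that by (auto simp: fock_map_def basis_ext_def)
  moreover have "fock_map x (v + w) = fock_map x v + fock_map x w" if "v \<in> S" "w \<in> S" for v w
    using that by (simp add: fock_map_def endo_add[OF endo_mono] basis_ext_fun_add[OF vector_space_axioms])
  moreover have "fock_map x (a \<cdot> v) = a \<cdot> fock_map x v" if "v \<in> S" for a v
    using that by (simp add: fock_map_def endo_scale[OF endo_mono] basis_ext_fun_scale[OF vector_space_axioms])
  ultimately show ?thesis by (simp add: endo_def)
qed

lemma fock_map_in [simp]: "v \<in> S \<Longrightarrow> fock_map x v \<in> S"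
  by (rule endo_in[OF endo_fock_map])

lemma fock_map_commute:
  assumes "endo T" "\<And>n v. v \<in> S \<Longrightarrow> T (\<phi> n v) = \<phi> n (T v)" "v \<in> S"
  shows "T (fock_map x v) = fock_map x (T v)"
  using assms(3) mono_commute[OF assms]
  by (simp add: fock_map_def basis_ext_def endo_sum[OF assms(1)] endo_scale[OF assms(1)])

text \<open>Checked on monomials: positive modes delete a factor, negative modes multiply from the
  left, and the zero mode does one or the other, scaled by \<open>1 / sqrt 2\<close>.\<close>

lemma phi_fock_map:
  assumes v: "v \<in> vac"
  shows "\<phi> n (fock_map x v) = fock_map (fock_psi n x) v"
proof (induction x rule: finsupp_induct)
  case (basis T)
  have vS: "v \<in> S" using v by simp
  note [simp] = d_xi_basis wedge_xi_basis fock_map_left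
  consider "n > 0" | "n < 0" | "n = 0" by linarith
  then show ?case
  proof cases
    case 1
    then show ?thesis using phi_mono[of "fset T" v "nat n"] v by (simp add: fock_psi_def)
  next
    case 2
    then have "\<phi> n w = crea (nat (- n)) w" for w by (simp add: crea_def)
    then show ?thesis
      using 2 vS crea_mono[of "fset T" v "nat (- n)"] crea_mono_mem[of "fset T" v "nat (- n)"]
      by (simp add: fock_psi_def)
  next
    case 3
    have "\<phi> 0 w = (1 / of_real (sqrt 2)) \<cdot> crea 0 w" for w by (simp add: crea_def)
    then show ?thesis
      using 3 vS crea_mono[of "fset T" v 0] crea_mono_mem[of "fset T" v 0]
      by (simp add: fock_psi_def left_sign_zero)
  qed
next
  case (add x y)
  then show ?case using v by (simp add: fock_map_left phi_simps fock_psi_add)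
next
  case (scale a x)
  then show ?case using v by (simp add: fock_map_left phi_simps fock_psi_scale)
qed simp

text \<open>Both operators are the same series in modes that \<open>fock_map\<close> intertwines,
  and on a given vector both series are finite.\<close>

lemma Lbar_fock_map:
  assumes v: "v \<in> vac"
  shows "Lbar k (fock_map x v) = fock_map (fock_L k x) v"
proof -
  have nord: "nord (- j) (j + k) (fock_map x v) = fock_map (normal_ordered (- j) (j + k) x) v" for j
    by (simp add: nord_def normal_ordered_def phi_fock_map[OF v] fock_map_left)
  define g where "g j = fscale (of_int j) (normal_ordered (- j) (j + k) x)" for j :: int
  have fin: "finite {j. g j \<noteq> 0}" unfolding g_def by (rule finite_normal_ordered)
  have "fock_map (Sum_any g) v = Sum_any (\<lambda>j. fock_map (g j) v)"
  proof -
    have "Sum_any (\<lambda>j. fock_map (g j) v) = (\<Sum>j | g j \<noteq> 0. fock_map (g j) v)"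
      by (rule Sum_any.expand_superset[OF fin]) auto
    then show ?thesis by (simp add: Sum_any.expand_set fock_map_left)
  qed
  then have "fock_map (Sum_any g) v = Sum_any (\<lambda>j. of_int j \<cdot> nord (- j) (j + k) (fock_map x v))"
    by (simp add: nord g_def fock_map_left)
  then show ?thesis
    by (simp add: Lbar_def fock_L_def fock_map_left g_def[abs_def])
qed

end

section \<open>Parity, independence of monomials and existence of even vacuum vectors\<close>

locale graded_clifford_rep = clifford_rep scale S \<phi>
  for scale :: "complex \<Rightarrow> 'v::ab_group_add \<Rightarrow> 'v" (infixr \<open>\<cdot>\<close> 75) and S :: "'v set" and \<phi> +
  fixes P :: "bit \<Rightarrow> 'v set"
  assumes subspace_P: "subspace (P i)"
    and P_in: "v \<in> P i \<Longrightarrow> v \<in> S"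
    and P_decompose: "v \<in> S \<Longrightarrow> \<exists>a\<in>P 0. \<exists>b\<in>P 1. v = a + b"
    and P_Int: "P 0 \<inter> P 1 = {0}"
    and phi_parity: "v \<in> P i \<Longrightarrow> \<phi> n v \<in> P (i + 1)"
begin

lemmas P_closed = subspace_0[OF subspace_P] subspace_add[OF subspace_P] subspace_scale[OF subspace_P]
  subspace_diff[OF subspace_P] subspace_neg[OF subspace_P] subspace_sum[OF subspace_P]

lemma crea_parity: "v \<in> P i \<Longrightarrow> crea n v \<in> P (i + 1)"
  unfolding crea_def by (metis P_closed(3) phi_parity)

lemma even_plus_odd_zero: "a \<in> P 0 \<Longrightarrow> b \<in> P 1 \<Longrightarrow> a + b = 0 \<Longrightarrow> a = 0 \<and> b = 0"
proof -
  assume *: "a \<in> P 0" "b \<in> P 1" "a + b = 0"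
  then have "a = - b" by (simp add: eq_neg_iff_add_eq_0)
  then have "a \<in> P 1" using * P_closed(5) by blast
  then have "a = 0" using * P_Int by blast
  with * show ?thesis by simp
qed

lemma mono_parity: "finite A \<Longrightarrow> v \<in> P i \<Longrightarrow> mono A v \<in> P (i + of_nat (card A))"
proof -
  assume *: "finite A" "v \<in> P i"
  have "foldr crea xs v \<in> P (i + of_nat (length xs))" for xs
  proof (induction xs)
    case Nil
    show ?case using * by (simp only: foldr.simps id_apply list.size of_nat_0 add_0_right)
  next
    case (Cons x xs)
    have "crea x (foldr crea xs v) \<in> P (i + of_nat (length xs) + 1)" by (rule crea_parity[OF Cons])
    then show ?case by (simp only: foldr.simps o_apply length_Cons of_nat_Suc add_ac)
  qed
  from this[of "sorted_list_of_set A"] show ?thesis using * by (simp only: mono_def length_sorted_list_of_set)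
qed

lemma fock_map_parity: "x \<in> ext_part k \<Longrightarrow> v \<in> P i \<Longrightarrow> fock_map x v \<in> P (k + i)"
proof -
  assume x: "x \<in> ext_part k" and v: "v \<in> P i"
  have "mono (fset A) v \<in> P (k + i)" if "A \<in> Poly_Mapping.keys x" for A
  proof -
    have "even (fcard A) \<longleftrightarrow> k = 0" using x that by (simp add: ext_part_def)
    moreover have "of_nat n = (if even n then 0 else 1 :: bit)" for n
      by (induction n) auto
    ultimately have "of_nat (card (fset A)) = k"
      by (cases k) (auto simp: fcard.rep_eq)
    then show ?thesis using mono_parity[of "fset A" v i] v by (simp only: finite_fset simp_thms add.commute)
  qed
  then show ?thesis unfolding fock_map_def basis_ext_def by (intro P_closed)
qed

text \<open>Induction on the positive indices that may occur: the annihilator of such an index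
  isolates the monomials containing it. The index \<open>0\<close> has no annihilator of its own, so
  the base case separates the monomials \<open>{}\<close> and \<open>{0}\<close> by parity; this is
  where evenness of the coefficients enters.\<close>

lemma mono_independent:
  assumes "finite B" "finite K" "inj_on a K" "\<And>i. i \<in> K \<Longrightarrow> a i \<subseteq> insert 0 B"
    and "\<And>i. i \<in> K \<Longrightarrow> w i \<in> vac \<inter> P 0" and "(\<Sum>i\<in>K. mono (a i) (w i)) = 0"
  shows "\<forall>i\<in>K. w i = 0"
  using assms
proof (induction B arbitrary: K a w rule: finite_induct)
  case empty
  let ?E = "{i \<in> K. a i = {}}" and ?O = "{i \<in> K. a i = {0}}"
  have "(\<Sum>i\<in>K. mono (a i) (w i)) = (\<Sum>i\<in>?E \<union> ?O. mono (a i) (w i))"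
    by (rule sum.cong) (use empty.prems(3) in auto)
  also have "\<dots> = (\<Sum>i\<in>?E. mono (a i) (w i)) + (\<Sum>i\<in>?O. mono (a i) (w i))"
    by (rule sum.union_disjoint) (use empty.prems(1) in auto)
  also have "\<dots> = (\<Sum>i\<in>?E. w i) + (\<Sum>i\<in>?O. crea 0 (w i))"
    by (intro arg_cong2[where f = "(+)"] sum.cong) (auto simp: mono_def)
  finally have "(\<Sum>i\<in>?E. w i) + (\<Sum>i\<in>?O. crea 0 (w i)) = 0" using empty.prems by simp
  moreover have "(\<Sum>i\<in>?E. w i) \<in> P 0" using empty.prems by (intro P_closed) auto
  moreover have "crea 0 (w i) \<in> P 1" if "i \<in> ?O" for i
    using empty.prems(4)[of i] that crea_parity[of "w i" 0 0] by simp
  then have "(\<Sum>i\<in>?O. crea 0 (w i)) \<in> P 1" by (intro P_closed)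
  ultimately have z: "(\<Sum>i\<in>?E. w i) = 0" "(\<Sum>i\<in>?O. crea 0 (w i)) = 0"
    using even_plus_odd_zero by blast+
  show ?case
  proof
    fix i assume i: "i \<in> K"
    then have "a i = {} \<or> a i = {0}" using empty.prems(3)[of i] by auto
    then show "w i = 0"
    proof
      assume "a i = {}"
      moreover have "j = i" if "j \<in> ?E" for j
        using inj_onD[OF empty.prems(2), of j i] that i \<open>a i = {}\<close> by simp
      ultimately have "?E = {i}" using i by blast
      then show ?thesis using z(1) by simp
    next
      assume "a i = {0}"
      moreover have "j = i" if "j \<in> ?O" for j
        using inj_onD[OF empty.prems(2), of j i] that i \<open>a i = {0}\<close> by simp
      ultimately have "?O = {i}" using i by blast
      then have "crea 0 (crea 0 (w i)) = 0" using z(2) by (simp add: crea_simps)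
      then show ?thesis using crea_twice[of "w i" 0] empty.prems(4)[OF i] by simp
    qed
  qed
next
  case (insert n B)
  show ?case
  proof (cases "n = 0")
    case True
    then show ?thesis using insert by auto
  next
    case False
    let ?K = "{i \<in> K. n \<in> a i}"
    have fin: "finite (a i)" if "i \<in> K" for i
      using insert.prems(3)[OF that] insert.hyps(1) by (meson finite_insert finite_subset)
    have wv: "w i \<in> vac" if "i \<in> K" for i using insert.prems(4)[OF that] by blast
    have 1: "\<forall>i\<in>?K. left_sign n (a i) \<cdot> w i = 0"
    proof (rule insert.IH[where a = "\<lambda>i. a i - {n}"])
      show "finite ?K" using insert.prems by simp
      show "inj_on (\<lambda>i. a i - {n}) ?K"
        using insert.prems(2) unfolding inj_on_def by (metis (lifting) insert_Diff mem_Collect_eq)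
      show "a i - {n} \<subseteq> insert 0 B" if "i \<in> ?K" for i using insert.prems(3) that by auto
      show "left_sign n (a i) \<cdot> w i \<in> vac \<inter> P 0" if "i \<in> ?K" for i
        using insert.prems(4) that by (auto intro: subspace_scale[OF subspace_vac] P_closed)
      \<comment> \<open>Applying \<open>\<phi> n\<close> kills the monomials without
        \<open>n\<close> and strips \<open>n\<close> from the others; the sign is absorbed into the
        coefficient.\<close>
      have "0 = \<phi> (int n) (\<Sum>i\<in>K. mono (a i) (w i))" by (simp add: insert.prems(5))
      also have "\<dots> = (\<Sum>i\<in>K. \<phi> (int n) (mono (a i) (w i)))"
        using wv by (intro phi_simps) auto
      also have "\<dots> = (\<Sum>i\<in>?K. mono (a i - {n}) (left_sign n (a i) \<cdot> w i))"
        by (rule sum.mono_neutral_cong_right)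
          (use insert.prems(1) False fin wv in \<open>auto simp: phi_mono endo_scale[OF endo_mono]\<close>)
      finally show "(\<Sum>i\<in>?K. mono (a i - {n}) (left_sign n (a i) \<cdot> w i)) = 0" by simp
    qed
    have 2: "\<forall>i\<in>K - ?K. w i = 0"
    proof (rule insert.IH[where a = a])
      show "finite (K - ?K)" using insert.prems by simp
      show "inj_on a (K - ?K)" using insert.prems(2) by (rule inj_on_subset) auto
      show "a i \<subseteq> insert 0 B" if "i \<in> K - ?K" for i using insert.prems(3) that by auto
      show "w i \<in> vac \<inter> P 0" if "i \<in> K - ?K" for i using insert.prems(4) that by auto
      have "(\<Sum>i\<in>K - ?K. mono (a i) (w i)) = (\<Sum>i\<in>K. mono (a i) (w i))"
        by (rule sum.mono_neutral_left)
          (use insert.prems(1) 1 in \<open>auto simp: left_sign_nonzero endo_zero[OF endo_mono]\<close>)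
      then show "(\<Sum>i\<in>K - ?K. mono (a i) (w i)) = 0" by (simp add: insert.prems(5))
    qed
    show ?thesis using 1 2 left_sign_nonzero by auto
  qed
qed

text \<open>Smoothness leaves finitely many annihilators acting nontrivially on a vector; apply them,
  from the top index downwards, as long as they do not kill.\<close>

lemma vacuum_exists:
  assumes "S \<noteq> {0}"
  shows "\<exists>v\<in>vac \<inter> P 0. v \<noteq> 0"
proof -
  have reduce: "\<exists>j. \<exists>u\<in>vac \<inter> P j. u \<noteq> 0"
    if "v \<in> P i" "v \<noteq> 0" "\<And>n. n > int N \<Longrightarrow> \<phi> n v = 0" for v i N
    using that
  proof (induction N arbitrary: v i)
    case 0
    then have "v \<in> vac" using P_in[OF 0(1)] by (intro vacI) auto
    then show ?case using 0 by blast
  next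
    case (Suc N)
    show ?case
    proof (cases "\<phi> (int (Suc N)) v = 0")
      case True
      have "\<phi> n v = 0" if "n > int N" for n
        using that True Suc.prems(3)[of n] by (cases "n = int (Suc N)") auto
      then show ?thesis using Suc.IH Suc.prems by blast
    next
      case False
      \<comment> \<open>The new vector is killed by \<open>\<phi> (Suc N)\<close>, which squares to
        zero, and by the higher modes, which anticommute with it. The bound therefore drops by
        one.\<close>
      have "\<phi> n (\<phi> (int (Suc N)) v) = 0" if "n > int N" for n
      proof (cases "n = int (Suc N)")
        case True
        then show ?thesis using phi_squared[of v n] P_in Suc.prems(1) by simp
      next
        case False
        then have "\<phi> n v = 0" using that Suc.prems(3)[of n] by simp
        then show ?thesis using phi_anticommute[of v n "int (Suc N)"] P_in Suc.prems(1) that by simp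
      qed
      then show ?thesis using Suc.IH phi_parity[OF Suc.prems(1)] False by blast
    qed
  qed
  obtain v where "v \<in> S" "v \<noteq> 0" using assms by auto
  then obtain a b where "a \<in> P 0" "b \<in> P 1" "v = a + b" using P_decompose by blast
  with \<open>v \<noteq> 0\<close> obtain i u where u: "u \<in> P i" "u \<noteq> 0" by (cases "a = 0") auto
  obtain N where N: "\<And>n. n > N \<Longrightarrow> \<phi> n u = 0" using phi_smooth[OF P_in[OF u(1)]] by blast
  \<comment> \<open>The smoothness bound may be negative, while the induction needs a natural
    number.\<close>
  have "\<phi> n u = 0" if "n > int (nat N)" for n using N[of n] that by (simp split: if_splits)
  from reduce[OF u this] obtain j x where x: "x \<in> vac" "x \<in> P j" "x \<noteq> 0" by blast
  show ?thesis
  proof (cases "j = 0")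
    case False
    then have j: "j = 1" by (cases j) auto
    have xS: "x \<in> S" using x by simp
    \<comment> \<open>An odd vacuum vector is moved into even degree by the zero mode, which is
      injective because its square is \<open>1/2\<close>.\<close>
    have "\<phi> 0 (\<phi> 0 x) \<noteq> 0" using phi_zero_squared[OF xS] x by simp
    then have "\<phi> 0 x \<noteq> 0" by auto
    moreover have "\<phi> n (\<phi> 0 x) = 0" if "n > 0" for n
      using that x phi_anticommute[OF xS, of n 0] by (simp add: phi_vac)
    then have "\<phi> 0 x \<in> vac" using xS by (intro vacI) auto
    moreover have "\<phi> 0 x \<in> P 0" using phi_parity[OF x(2)] j by simp
    ultimately show ?thesis by blast
  qed (use x in auto)
qed

end

section \<open>Modules given on generators\<close>

lemma carr_fv: "carr fermion_virasoro = UNIV"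
proof -
  have "x \<in> carr fermion_virasoro" for x
  proof (induction x rule: finsupp_induct)
    case (basis g)
    have "bv g \<in> part fermion_virasoro (gen_parity g)" by (rule bv_in_part) simp
    then show ?case using part_subset_carr[OF super_vector_space_fv] by blast
  qed (use subspace_carr[OF super_vector_space_fv] in
        \<open>auto simp: fs.subspace_0 fs.subspace_add fs.subspace_scale\<close>)
  then show ?thesis by auto
qed

lemma basis_ext_comp:
  assumes "vector_space s"
  shows "basis_ext s f (basis_ext fscale h x) = basis_ext s (\<lambda>g. basis_ext s f (h g)) x"
  by (induction x rule: finsupp_induct)
     (simp_all add: basis_ext_add[OF assms] basis_ext_scale[OF assms] basis_ext_single[OF assms]
       basis_ext_add[OF vector_space_fscale] basis_ext_scale[OF vector_space_fscale]
       basis_ext_single[OF vector_space_fscale])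

text \<open>The module axioms are bilinear in the algebra elements, so relations between pairs of
  generators suffice.\<close>

lemma super_module_from_generators:
  assumes W: "super_vector_space W"
    and act: "act W = (\<lambda>x v. basis_ext (scl W) (\<lambda>g. a g v) x)"
    and add: "\<And>g v w. v \<in> carr W \<Longrightarrow> w \<in> carr W \<Longrightarrow> a g (v + w) = a g v + a g w"
    and scale: "\<And>g c v. v \<in> carr W \<Longrightarrow> a g (scl W c v) = scl W c (a g v)"
    and parity: "\<And>g j v. v \<in> part W j \<Longrightarrow> a g v \<in> part W (gen_parity g + j)"
    and bracket: "\<And>g h v. v \<in> carr W \<Longrightarrow> basis_ext (scl W) (\<lambda>k. a k v) (gen_bracket g h)
        = a g (a h v) - scl W (koszul (gen_parity g) (gen_parity h)) (a h (a g v))"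
  shows "super_module fermion_virasoro W"
proof -
  interpret vector_space "scl W" using W by (simp add: super_vector_space_def)
  note ext = basis_ext_add[OF vector_space_axioms] basis_ext_scale[OF vector_space_axioms]
    basis_ext_single[OF vector_space_axioms]
  note sub = subspace_carr[OF W]
  have subP: "subspace (part W i)" for i using W by (simp add: super_vector_space_def)
  have inP: "act W x v \<in> part W (i + j)"
    if "x \<in> part fermion_virasoro i" "v \<in> part W j" for i j x v
  proof -
    have "a g v \<in> part W (i + j)" if "g \<in> Poly_Mapping.keys x" for g
      using parity[OF \<open>v \<in> part W j\<close>, of g] \<open>x \<in> _\<close> that by (auto simp: fv_part_iff)
    then show ?thesis unfolding act basis_ext_def
      by (intro subspace_sum[OF subP] subspace_scale[OF subP])
  qed
  have a_in: "a g v \<in> carr W" if v: "v \<in> carr W" for g v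
  proof -
    obtain b c where "b \<in> part W 0" "c \<in> part W (0 + 1)" "v = b + c" using carr_decompose[OF W v] .
    then show ?thesis
      using parity[of b 0 g] parity[of c 1 g] part_subset_carr[OF W] subspace_add[OF sub] add[of b c g]
      by (metis add_0_left subsetD)
  qed
  have act_add: "act W x (v + w) = act W x v + act W x w" if "v \<in> carr W" "w \<in> carr W" for x v w
    using that by (simp add: act add basis_ext_def scale_right_distrib sum.distrib)
  have act_scale: "act W x (scl W c v) = scl W c (act W x v)" if "v \<in> carr W" for x v c
    using that by (simp add: act scale basis_ext_def scale_sum_right mult.commute)
  have act_in: "act W x v \<in> carr W" if "v \<in> carr W" for x v
    using that a_in unfolding act basis_ext_def by (intro subspace_sum[OF sub] subspace_scale[OF sub])
  have act_left: "act W (x + y) v = act W x v + act W y v" "act W (fscale c x) v = scl W c (act W x v)"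
      "act W 0 v = 0" for x y c v
    by (simp_all add: act ext)
  have act_bv: "act W (bv g) v = a g v" for g v by (simp add: act ext)
  \<comment> \<open>The second argument is extended linearly first and the first argument
    afterwards. Homogeneity keeps the Koszul sign constant over all basis vectors involved.\<close>
  have 1: "act W (fvb (bv g) y) v = a g (act W y v) - scl W (koszul (gen_parity g) j) (act W y (a g v))"
    if y: "y \<in> part fermion_virasoro j" and v: "v \<in> carr W" for g j y v
  proof (induction y rule: finsupp_induct)
    case zero
    have "a g 0 = 0" using scale[of 0 g 0] subspace_0[OF sub] by simp
    then show ?case by (simp add: fvb_linear act_left)
  next
    case (basis h)
    then have "gen_parity h = j" using y by (auto simp: fv_part_iff)
    then show ?case using bracket[OF v, of g h] by (simp add: fvb_basis act_bv) (simp add: act)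
  next
    case (add u w)
    then show ?case using v act_in by (simp add: fvb_linear act_left assms(3) algebra_simps)
  next
    case (scale c u)
    then show ?case using v act_in
      by (simp add: fvb_linear act_left assms(4) scale_right_diff_distrib mult.commute)
  qed
  have 2: "act W (fvb x y) v = act W x (act W y v) - scl W (koszul i j) (act W y (act W x v))"
    if x: "x \<in> part fermion_virasoro i" and y: "y \<in> part fermion_virasoro j" and v: "v \<in> carr W" for i j x y v
  proof (induction x rule: finsupp_induct)
    case zero
    have "act W y 0 = 0" using act_scale[of 0 y 0] subspace_0[OF sub] by simp
    then show ?case by (simp add: fvb_linear act_left)
  next
    case (basis g)
    then have "gen_parity g = i" using x by (auto simp: fv_part_iff)
    then show ?case using 1[OF y v, of g] by (simp add: act_bv)
  next
    case (add u w)
    then show ?case using v act_in by (simp add: fvb_linear act_left act_add algebra_simps)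
  next
    case (scale c u)
    then show ?case using v act_in
      by (simp add: fvb_linear act_left act_scale scale_right_diff_distrib mult.commute)
  qed
  show ?thesis
    unfolding super_module_def bilinear_on_def scl_fv
    by (intro conjI allI ballI W act_left(1,2) act_add act_scale inP 2)
qed

lemma super_module_virasoro:
  assumes "super_module fermion_virasoro W"
  shows "super_module virasoro W"
proof -
  note W = assms[unfolded super_module_def bilinear_on_def scl_fv carr_fv]
  have "act W x v \<in> part W (i + j)" if "x \<in> part virasoro i" "v \<in> part W j" for i j x v
    using W that(2) subsetD[OF virasoro_part_subset that(1)] by blast
  moreover have "act W (fvb x y) v = act W x (act W y v) - scl W (koszul i j) (act W y (act W x v))"
    if "x \<in> part virasoro i" "y \<in> part virasoro j" "v \<in> carr W" for i j x y v
    using W that subsetD[OF virasoro_part_subset that(1)] subsetD[OF virasoro_part_subset that(2)] by blast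
  ultimately show ?thesis using W
    unfolding super_module_def bilinear_on_def virasoro_sel by simp
qed

section \<open>Spans of values of bilinear maps\<close>

text \<open>Each left factor is expanded in the basis and its coefficients are moved to the right
  factor. The result serves both the span of \<open>fock_map\<close> in the module and the span of
  the pure tensors.\<close>

lemma span_bilinear_representation:
  fixes F :: "('k \<Rightarrow>\<^sub>0 complex) \<Rightarrow> 'u::ab_group_add \<Rightarrow> 'w::ab_group_add"
  assumes s: "vector_space s" and s': "vector_space s'" and U: "module.subspace s U"
    and left: "\<And>x y u. u \<in> U \<Longrightarrow> F (x + y) u = F x u + F y u"
      "\<And>c x u. u \<in> U \<Longrightarrow> F (fscale c x) u = s' c (F x u)"
    and right: "\<And>x u v. u \<in> U \<Longrightarrow> v \<in> U \<Longrightarrow> F x (u + v) = F x u + F x v"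
      "\<And>c x u. u \<in> U \<Longrightarrow> F x (s c u) = s' c (F x u)"
    and t: "t \<in> module.span s' {F x u | x u. u \<in> U}"
  shows "\<exists>K w. finite K \<and> (\<forall>k. w k \<in> U) \<and> (\<forall>k. k \<notin> K \<longrightarrow> w k = 0) \<and> t = (\<Sum>k\<in>K. F (bv k) (w k))"
proof -
  interpret U: vector_space s by fact
  interpret W: vector_space s' by fact
  note U_closed = U.subspace_0[OF U] U.subspace_add[OF U] U.subspace_scale[OF U]
  have F_zero: "F x 0 = 0" for x using right(2)[of 0 x 0] U_closed by simp
  have F_expand: "F x u = (\<Sum>k\<in>Poly_Mapping.keys x. F (bv k) (s (Poly_Mapping.lookup x k) u))" if u: "u \<in> U" for x u
  proof -
    have "F 0 u = 0" using left(2)[OF u, of 0 0] by simp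
    have "F x u = basis_ext s' (\<lambda>k. F (bv k) u) x"
      by (induction x rule: finsupp_induct)
        (simp_all add: left[OF u] \<open>F 0 u = 0\<close> basis_ext_add[OF s'] basis_ext_scale[OF s'] basis_ext_single[OF s'])
    then show ?thesis by (simp add: basis_ext_def right(2)[OF u])
  qed
  show ?thesis using t
  proof (induction rule: W.span_induct_alt)
    case base
    show ?case by (rule exI[of _ "{}"], rule exI[of _ "\<lambda>_. 0"]) (simp add: U_closed)
  next
    case (step c y t)
    then obtain x u K w where y: "y = F x u" and u: "u \<in> U"
      and K: "finite K" "\<And>k. w k \<in> U" "\<And>k. k \<notin> K \<Longrightarrow> w k = 0" "t = (\<Sum>k\<in>K. F (bv k) (w k))"
      by auto
    \<comment> \<open>Both coefficient families vanish off their own index sets, so both sums extend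
      to the union and can be added termwise.\<close>
    let ?K = "K \<union> Poly_Mapping.keys x"
    let ?d = "\<lambda>k. s (Poly_Mapping.lookup x k) (s c u)"
    have cu: "s c u \<in> U" using u U_closed by blast
    have "(\<Sum>k\<in>?K. F (bv k) (w k + ?d k)) = (\<Sum>k\<in>?K. F (bv k) (w k)) + (\<Sum>k\<in>?K. F (bv k) (?d k))"
      by (simp only: right(1)[OF K(2) U_closed(3)[OF cu]] sum.distrib)
    also have "(\<Sum>k\<in>?K. F (bv k) (w k)) = t"
      unfolding K(4) by (rule sum.mono_neutral_right) (use K in \<open>auto simp: F_zero\<close>)
    also have "(\<Sum>k\<in>?K. F (bv k) (?d k)) = (\<Sum>k\<in>Poly_Mapping.keys x. F (bv k) (?d k))"
      by (rule sum.mono_neutral_right) (use K(1) in \<open>auto simp: F_zero in_keys_iff\<close>)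
    also have "\<dots> = s' c y" using F_expand[OF cu, of x] right(2)[OF u, of x c] y by simp
    finally have "s' c y + t = (\<Sum>k\<in>?K. F (bv k) (w k + ?d k))" by (simp add: add.commute)
    moreover have "\<forall>k. w k + ?d k \<in> U" using K(2) cu U_closed by blast
    moreover have "\<forall>k. k \<notin> ?K \<longrightarrow> w k + ?d k = 0" using K(3) by (auto simp: in_keys_iff)
    moreover have "finite ?K" using K(1) by simp
    ultimately show ?case by (intro exI[of _ ?K] exI[of _ "\<lambda>k. w k + ?d k"] conjI)
  qed
qed

section \<open>The twisted Fock space\<close>

lemma carr_twist_fock: "carr (twist r fock) = UNIV"
  and super_vector_space_twist_fock: "super_vector_space (twist r fock)"
proof -
  have sel: "part (twist r fock) = ext_part" "scl (twist r fock) = fscale"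
    by (simp_all add: twist_def fock_def)
  have sub: "fs.subspace (ext_part i)" for i
    unfolding ext_part_def by (rule subspace_keys)
  moreover have "x = 0" if "x \<in> ext_part 0" "x \<in> ext_part 1" for x
  proof -
    have "Poly_Mapping.keys x = {}" using that by (auto simp: ext_part_def)
    then show ?thesis by simp
  qed
  moreover have "0 \<in> ext_part i" for i by (simp add: ext_part_def)
  ultimately show svs: "super_vector_space (twist r fock)"
    unfolding super_vector_space_def sel by (auto simp: vector_space_fscale)
  have "x \<in> carr (twist r fock)" for x
  proof (induction x rule: finsupp_induct)
    case (basis A)
    have "bv A \<in> part (twist r fock) (of_bool (odd (fcard A)))"
      by (auto simp: sel ext_part_def)
    then show ?case using part_subset_carr[OF svs] by blast
  qed (use subspace_carr[OF svs] in
        \<open>auto simp: sel fs.subspace_0 fs.subspace_add fs.subspace_scale\<close>)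
  then show "carr (twist r fock) = UNIV" by auto
qed

lemma fock_L_add: "fock_L k (x + y) = fock_L k x + fock_L k y"
  and fock_L_scale: "fock_L k (fscale c x) = fscale c (fock_L k x)"
proof -
  let ?g = "\<lambda>x j. fscale (of_int j) (normal_ordered (- j) (j + k) x)"
  have "?g (x + y) j = ?g x j + ?g y j" for j
    by (simp add: normal_ordered_def fock_psi_add fs.scale_right_distrib fs.scale_right_diff_distrib)
  then have "Sum_any (?g (x + y)) = Sum_any (?g x) + Sum_any (?g y)"
    by (simp add: Sum_any.distrib[OF finite_normal_ordered finite_normal_ordered])
  then show "fock_L k (x + y) = fock_L k x + fock_L k y"
    by (simp add: fock_L_def fs.scale_right_distrib algebra_simps)
  have g: "?g (fscale c x) j = fscale c (?g x j)" for j
    by (simp add: normal_ordered_def fock_psi_scale mult.commute)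
  have "Sum_any (\<lambda>j. fscale c (?g x j)) = (\<Sum>j | ?g x j \<noteq> 0. fscale c (?g x j))"
    by (rule Sum_any.expand_superset[OF finite_normal_ordered[of k x]]) auto
  then have "Sum_any (?g (fscale c x)) = fscale c (Sum_any (?g x))"
    unfolding g by (simp only: Sum_any.expand_set fs.scale_sum_right)
  then show "fock_L k (fscale c x) = fscale c (fock_L k x)"
    by (simp add: fock_L_def fs.scale_right_distrib mult.commute)
qed

lemma fock_gen_add: "fock_gen g (x + y) = fock_gen g x + fock_gen g y"
  and fock_gen_scale: "fock_gen g (fscale c x) = fscale c (fock_gen g x)"
  by (cases g; simp add: fock_L_add fock_L_scale fock_psi_add fock_psi_scale fs.scale_right_distrib mult.commute)+

abbreviation twact :: "complex \<Rightarrow> fv \<Rightarrow> ext \<Rightarrow> ext" where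
  "twact r \<equiv> act (twist r fock)"

lemma twact_eq: "twact r y x = basis_ext fscale (\<lambda>g. fock_gen g x) (sigma r y)"
  by (simp add: twist_def fock_def)

lemma twact_right: "twact r y (x + x') = twact r y x + twact r y x'"
    "twact r y (fscale c x) = fscale c (twact r y x)"
  by (simp_all add: twact_eq fock_gen_add fock_gen_scale basis_ext_fun_add[OF vector_space_fscale]
      basis_ext_fun_scale[OF vector_space_fscale])

lemma twact_left: "twact r (y + y') x = twact r y x + twact r y' x"
    "twact r (fscale c y) x = fscale c (twact r y x)" "twact r 0 x = 0"
  by (simp_all add: twact_eq sigma_def basis_ext_add[OF vector_space_fscale] basis_ext_scale[OF vector_space_fscale])

lemma twact_gens: "twact r (bv (L k)) x = fock_L k x" "twact r (bv (Psi n)) x = fscale r (fock_psi n x)"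
    "twact r (bv C) x = fscale (1/2) x" "twact r (bv Z) x = fscale (r\<^sup>2) x"
  by (simp_all add: twact_eq sigma_def basis_ext_scale[OF vector_space_fscale] basis_ext_single[OF vector_space_fscale])

section \<open>Splitting off the Fock space\<close>

locale fv_module =
  fixes M :: "(fv, 'm::ab_group_add) smodule" and l r :: complex
  assumes module: "super_module fermion_virasoro M" and smooth: "smooth_fv M"
    and level: "has_level M l" and nonzero: "l \<noteq> 0" and root: "r\<^sup>2 = l"
begin

abbreviation sclM (infixr \<open>\<cdot>\<close> 75) where "a \<cdot> v \<equiv> scl M a v"

text \<open>Since \<open>Z\<close> acts by \<open>l = r^2\<close>, division by \<open>r\<close>
  normalises the anticommutators to those of level \<open>1\<close>.\<close>

definition \<phi> :: "int \<Rightarrow> 'm \<Rightarrow> 'm" where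
  "\<phi> n v = (1 / r) \<cdot> act M (bv (Psi n)) v"

lemma svs: "super_vector_space M"
  using module by (simp add: super_module_def)

lemma r_nonzero: "r \<noteq> 0"
  using nonzero root by auto

lemma vector_space_M: "vector_space (scl M)"
  using svs by (simp add: super_vector_space_def)

sublocale carrier_space "scl M" "carr M"
  by (intro carrier_space.intro vector_space_M carrier_space_axioms.intro subspace_carr svs)

lemma endo_act: "endo (act M x)"
  using super_module_actD[OF module super_vector_space_fv, of x] by (auto simp: endo_def carr_fv)

lemma act_in [simp]: "v \<in> carr M \<Longrightarrow> act M x v \<in> carr M"
  by (rule endo_in[OF endo_act])

lemmas act_simps = endo_simps[OF endo_act] endo_zero[OF endo_act]

lemma act_left:
  assumes "v \<in> carr M"
  shows "act M (x + y) v = act M x v + act M y v" "act M (fscale a x) v = a \<cdot> act M x v" "act M 0 v = 0"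
proof -
  show add: "act M (x + y) v = act M x v + act M y v"
    and scale: "act M (fscale a x) v = a \<cdot> act M x v" for x y a
    using module assms unfolding super_module_def bilinear_on_def by (auto simp: carr_fv)
  show "act M 0 v = 0" using scale[of 0 0] by simp
qed

lemma act_parity: "v \<in> part M j \<Longrightarrow> act M (bv g) v \<in> part M (gen_parity g + j)"
  using module bv_in_part[of g] unfolding super_module_def by blast

lemma act_bracket:
  "v \<in> carr M \<Longrightarrow> act M (gen_bracket g h) v = act M (bv g) (act M (bv h) v)
     - koszul (gen_parity g) (gen_parity h) \<cdot> act M (bv h) (act M (bv g) v)"
  using module bv_in_part[of g] bv_in_part[of h] unfolding super_module_def fvb_basis[symmetric] by blast

lemma act_Z: "v \<in> carr M \<Longrightarrow> act M (bv Z) v = l \<cdot> v"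
  using level by (simp add: has_level_def)

lemma act_Psi: "v \<in> carr M \<Longrightarrow> act M (bv (Psi n)) v = r \<cdot> \<phi> n v"
  using r_nonzero by (simp add: \<phi>_def)

lemma clifford_phi:
  assumes v: "v \<in> carr M"
  shows "\<phi> m (\<phi> n v) + \<phi> n (\<phi> m v) = (if m + n = 0 then v else 0)"
proof -
  have iff: "m = - n \<longleftrightarrow> m + n = 0" by auto
  have "act M (bv (Psi m)) (act M (bv (Psi n)) v) + act M (bv (Psi n)) (act M (bv (Psi m)) v)
      = (if m + n = 0 then l \<cdot> v else 0)"
    using act_bracket[OF v, of "Psi m" "Psi n"] v by (auto simp: koszul_def iff act_left act_Z)
  then have "(1 / r\<^sup>2) \<cdot> (act M (bv (Psi m)) (act M (bv (Psi n)) v) + act M (bv (Psi n)) (act M (bv (Psi m)) v))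
      = (1 / r\<^sup>2) \<cdot> (if m + n = 0 then l \<cdot> v else 0)" by simp
  then show ?thesis
    using v nonzero root by (auto simp: \<phi>_def act_simps scale_right_distrib power2_eq_square)
qed

lemma smooth_phi: "v \<in> carr M \<Longrightarrow> \<exists>N. \<forall>n>N. \<phi> n v = 0"
  using smooth unfolding smooth_fv_def \<phi>_def by (metis scale_zero_right)

sublocale graded_clifford_rep "scl M" "carr M" \<phi> "part M"
proof unfold_locales
  show "endo (\<phi> n)" for n unfolding \<phi>_def[abs_def] by (rule endo_smult[OF endo_act])
  show sub: "subspace (part M i)" for i using svs by (simp add: super_vector_space_def)
  show "v \<in> carr M" if "v \<in> part M i" for v i using that part_subset_carr[OF svs] by blast
  show "\<exists>a\<in>part M 0. \<exists>b\<in>part M 1. v = a + b" if "v \<in> carr M" for v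
    using that by (auto simp: carr_def)
  show "part M 0 \<inter> part M 1 = {0}" using svs by (simp add: super_vector_space_def)
  show "\<phi> n v \<in> part M (i + 1)" if "v \<in> part M i" for v i n
  proof -
    have "act M (bv (Psi n)) v \<in> part M (i + 1)"
      using act_parity[OF that, of "Psi n"] by (simp only: gen_parity.simps add.commute)
    then show ?thesis unfolding \<phi>_def by (rule subspace_scale[OF sub])
  qed
qed (use clifford_phi smooth_phi in auto)

text \<open>The coset construction: the difference of two Virasoro actions with the same commutators
  with the modes.\<close>

definition L' :: "int \<Rightarrow> 'm \<Rightarrow> 'm" where
  "L' k v = act M (bv (L k)) v - Lbar k v"

definition C' :: "'m \<Rightarrow> 'm" where
  "C' v = act M (bv C) v - (1 / 2) \<cdot> v"

lemma endo_L': "endo (L' k)" and endo_C': "endo C'"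
  unfolding L'_def[abs_def] C'_def[abs_def]
  by (rule endo_minus[OF endo_act endo_Lbar] endo_minus[OF endo_act endo_smult[OF endo_id]])+

lemma L'_phi:
  assumes v: "v \<in> carr M"
  shows "L' k (\<phi> n v) = \<phi> n (L' k v)"
proof -
  have "act M (bv (L k)) (act M (bv (Psi n)) v) - act M (bv (Psi n)) (act M (bv (L k)) v)
      = (- of_int n - of_int k / 2) \<cdot> act M (bv (Psi (k + n))) v"
    using act_bracket[OF v, of "L k" "Psi n"] v by (simp add: koszul_def act_left)
  then have "(1 / r) \<cdot> (act M (bv (L k)) (act M (bv (Psi n)) v) - act M (bv (Psi n)) (act M (bv (L k)) v))
      = (1 / r) \<cdot> ((- of_int n - of_int k / 2) \<cdot> act M (bv (Psi (k + n))) v)" by simp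
  then have "act M (bv (L k)) (\<phi> n v) - \<phi> n (act M (bv (L k)) v) = (- of_int n - of_int k / 2) \<cdot> \<phi> (k + n) v"
    using v by (simp add: \<phi>_def act_simps scale_right_diff_distrib mult.commute)
  also have "\<dots> = Lbar k (\<phi> n v) - \<phi> n (Lbar k v)" by (rule Lbar_phi[OF v, symmetric])
  finally show ?thesis using v by (simp add: L'_def phi_simps algebra_simps)
qed

lemma C'_phi:
  assumes v: "v \<in> carr M"
  shows "C' (\<phi> n v) = \<phi> n (C' v)"
  using act_bracket[OF v, of C "Psi n"] v
  by (simp add: C'_def \<phi>_def koszul_def act_left act_simps scale_right_diff_distrib mult.commute)

lemma C'_L':
  assumes v: "v \<in> carr M"
  shows "C' (L' k v) = L' k (C' v)"
proof -
  have "C' (Lbar k v) = Lbar k (C' v)" by (rule Lbar_commute[OF endo_C' C'_phi v])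
  moreover have "C' (act M (bv (L k)) v) = act M (bv (L k)) (C' v)"
    using act_bracket[OF v, of C "L k"] v
    by (simp add: C'_def koszul_def act_left act_simps)
  ultimately show ?thesis using v by (simp add: L'_def endo_diff[OF endo_C'])
qed

text \<open>The cross terms cancel because \<open>L'\<close> commutes with every
  \<open>Lbar\<close>, so the commutators of the two summands add up. The coefficient
  \<open>1/24\<close> from \<open>Lbar_bracket\<close> is half of \<open>1/12\<close>, which
  explains the shift by \<open>1/2\<close> in \<open>C'\<close>.\<close>

lemma L'_bracket:
  assumes v: "v \<in> carr M"
  shows "L' m (L' n v) - L' n (L' m v) = of_int (m - n) \<cdot> L' (m + n) v
    + (if m = - n then ((of_int m ^ 3 - of_int m) / 12) \<cdot> C' v else 0)"
proof -
  let ?A = "\<lambda>k. act M (bv (L k))"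
  have A: "?A k w = L' k w + Lbar k w" for k w by (simp add: L'_def)
  have in_L': "L' k w \<in> carr M" if "w \<in> carr M" for k w using that by (rule endo_in[OF endo_L'])
  have comm: "L' k (Lbar j w) = Lbar j (L' k w)" if "w \<in> carr M" for k j w
    by (rule Lbar_commute[OF endo_L' L'_phi that])
  have "?A m (?A n v) - ?A n (?A m v) = of_int (m - n) \<cdot> ?A (m + n) v
    + (if m = - n then ((of_int m ^ 3 - of_int m) / 12) \<cdot> act M (bv C) v else 0)"
    using act_bracket[OF v, of "L m" "L n"] v by (auto simp: koszul_def act_left)
  moreover have "?A m (?A n v) - ?A n (?A m v)
      = (L' m (L' n v) - L' n (L' m v)) + (Lbar m (Lbar n v) - Lbar n (Lbar m v))"
    using v by (simp add: A endo_add[OF endo_L'] endo_add[OF endo_Lbar] in_L' comm)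
  moreover note Lbar_bracket[OF v, of m n]
  ultimately have "L' m (L' n v) - L' n (L' m v) = of_int (m - n) \<cdot> ?A (m + n) v
    + (if m = - n then ((of_int m ^ 3 - of_int m) / 12) \<cdot> act M (bv C) v else 0)
    - (of_int (m - n) \<cdot> Lbar (m + n) v + (if m = - n then (of_int m ^ 3 - of_int m) / 24 else 0) \<cdot> v)"
    by (simp add: algebra_simps)
  also have "\<dots> = of_int (m - n) \<cdot> L' (m + n) v
    + (if m = - n then ((of_int m ^ 3 - of_int m) / 12) \<cdot> C' v else 0)"
    by (simp add: A C'_def scale_right_distrib scale_right_diff_distrib)
  finally show ?thesis .
qed

section \<open>The multiplicity space and its Virasoro action\<close>

definition \<Omega> :: "'m set" where
  "\<Omega> = vac \<inter> part M 0"

lemma subspace_Omega: "subspace \<Omega>"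
  unfolding \<Omega>_def by (intro subspace_inter subspace_vac subspace_P)

lemmas Omega_closed = subspace_0[OF subspace_Omega] subspace_add[OF subspace_Omega]
  subspace_diff[OF subspace_Omega] subspace_scale[OF subspace_Omega] subspace_sum[OF subspace_Omega]

lemma Omega_vac: "v \<in> \<Omega> \<Longrightarrow> v \<in> vac"
  and Omega_even: "v \<in> \<Omega> \<Longrightarrow> v \<in> part M 0"
  and Omega_carr: "v \<in> \<Omega> \<Longrightarrow> v \<in> carr M"
  by (simp_all add: \<Omega>_def)

lemma Lbar_parity: "v \<in> part M i \<Longrightarrow> Lbar k v \<in> part M i"
proof -
  assume v: "v \<in> part M i"
  have bit2: "i + 1 + 1 = i" by (simp add: add.assoc)
  have "\<phi> m (\<phi> n v) \<in> part M i" for m n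
    using phi_parity[OF phi_parity[OF v, of n], of m] by (simp only: bit2)
  then have "nord m n v \<in> part M i" for m n by (simp add: nord_def P_closed)
  then have "Sum_any (\<lambda>j. of_int j \<cdot> nord (- j) (j + k) v) \<in> part M i"
    unfolding Sum_any.expand_set by (intro P_closed(6) P_closed(3))
  then show ?thesis unfolding Lbar_def using v by (intro P_closed(2,3))
qed

lemma commuting_Omega:
  assumes "endo T" "\<And>n v. v \<in> carr M \<Longrightarrow> T (\<phi> n v) = \<phi> n (T v)"
    and "\<And>v. v \<in> part M 0 \<Longrightarrow> T v \<in> part M 0" and v: "v \<in> \<Omega>"
  shows "T v \<in> \<Omega>"
proof -
  have "T v \<in> vac"
  proof (rule vacI)
    show "T v \<in> carr M" using endo_in[OF assms(1)] Omega_carr[OF v] .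
    show "\<phi> n (T v) = 0" if "n > 0" for n
      using assms(2)[OF Omega_carr[OF v], of n] phi_vac[OF Omega_vac[OF v] that] endo_zero[OF assms(1)] by simp
  qed
  then show ?thesis using assms(3)[OF Omega_even[OF v]] by (simp add: \<Omega>_def)
qed

lemma L'_Omega: "v \<in> \<Omega> \<Longrightarrow> L' k v \<in> \<Omega>"
proof (rule commuting_Omega[OF endo_L' L'_phi])
  show "L' k v \<in> part M 0" if "v \<in> part M 0" for v
    using act_parity[OF that, of "L k"] Lbar_parity[OF that, of k] by (simp add: L'_def P_closed)
qed

lemma C'_Omega: "v \<in> \<Omega> \<Longrightarrow> C' v \<in> \<Omega>"
proof (rule commuting_Omega[OF endo_C' C'_phi])
  show "C' v \<in> part M 0" if "v \<in> part M 0" for v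
    using act_parity[OF that, of C] that by (simp add: C'_def P_closed)
qed

text \<open>All generators are included, those of \<open>F\<close> acting by zero, so that one
  structure serves as the Virasoro module and as its inflation.\<close>

fun vgen :: "fv_gen \<Rightarrow> 'm \<Rightarrow> 'm" where
  "vgen (L k) v = L' k v"
| "vgen C v = C' v"
| "vgen (Psi n) v = 0"
| "vgen Z v = 0"

lemma endo_vgen: "endo (vgen g)"
  using endo_L' endo_C' endo_const_zero by (cases g) (simp_all add: endo_def)

lemma vgen_Omega: "v \<in> \<Omega> \<Longrightarrow> vgen g v \<in> \<Omega>"
  by (cases g) (simp_all add: L'_Omega C'_Omega Omega_closed)

text \<open>The multiplicity space lives in degree \<open>0\<close> only: \<open>\<phi>\<^sub>0\<close> exchanges the even and the odd vacuum
  vectors, and the factor \<open>span {1, \<xi>\<^sub>0}\<close> of the Fock space accounts for both.\<close>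

definition V :: "(fv, 'm) smodule" where
  "V = \<lparr> part = (\<lambda>i. if i = 0 then \<Omega> else {0}), scl = scl M,
         act = (\<lambda>x v. basis_ext (scl M) (\<lambda>g. vgen g v) x) \<rparr>"

lemma V_sel [simp]: "part V 0 = \<Omega>" "part V 1 = {0}" "scl V = scl M" "carr V = \<Omega>"
  by (auto simp: V_def carr_def)

lemma act_V: "act V x v = basis_ext (scl M) (\<lambda>g. vgen g v) x"
  by (simp add: V_def)

lemma act_V_left: "act V (x + y) v = act V x v + act V y v" "act V (fscale a x) v = a \<cdot> act V x v"
    "act V 0 v = 0" "act V (bv g) v = vgen g v"
  by (simp_all add: act_V basis_ext_add[OF vector_space_M] basis_ext_scale[OF vector_space_M]
      basis_ext_single[OF vector_space_M])

lemma act_V_in: "subspace U \<Longrightarrow> (\<And>g. vgen g v \<in> U) \<Longrightarrow> act V x v \<in> U"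
  unfolding act_V basis_ext_def by (intro subspace_sum subspace_scale)

lemma act_V_right: "v \<in> carr M \<Longrightarrow> w \<in> carr M \<Longrightarrow> act V x (v + w) = act V x v + act V x w"
    "v \<in> carr M \<Longrightarrow> act V x (a \<cdot> v) = a \<cdot> act V x v"
  by (simp_all add: act_V endo_simps[OF endo_vgen] basis_ext_fun_add[OF vector_space_M]
      basis_ext_fun_scale[OF vector_space_M])

lemma inflate_V: "inflate V = V"
proof -
  have *: "basis_ext (scl M) (\<lambda>g. vgen g v) (vir_proj_gen g) = vgen g v" for g v
    by (cases g) (simp_all add: basis_ext_single[OF vector_space_M])
  have "act V (basis_ext fscale vir_proj_gen x) v = act V x v" for x v
    by (simp only: act_V basis_ext_comp[OF vector_space_M] *)
  then have "(\<lambda>x. act V (basis_ext fscale vir_proj_gen x)) = act V" by (intro ext)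
  then show ?thesis by (simp add: inflate_def)
qed

lemma super_vector_space_V: "super_vector_space V"
proof -
  have "subspace (part V i)" for i
    using subspace_Omega subspace_single_0 by (cases i) auto
  then show ?thesis
    using vector_space_M Omega_closed(1) by (auto simp: super_vector_space_def)
qed

text \<open>The brackets among \<open>L\<close> and \<open>C\<close> are \<open>L'_bracket\<close>
  and \<open>C'_L'\<close>. A bracket involving \<open>Psi\<close> or \<open>Z\<close> again lies in
  their span, where everything acts by zero.\<close>

lemma super_module_V: "super_module fermion_virasoro V"
proof (rule super_module_from_generators[OF super_vector_space_V])
  show "act V = (\<lambda>x v. basis_ext (scl V) (\<lambda>g. vgen g v) x)" by (simp add: V_def)
  show "vgen g v \<in> part V (gen_parity g + j)" if "v \<in> part V j" for g j v
  proof (cases "j = 0")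
    case True
    then show ?thesis using that vgen_Omega[of v g] by (cases g) auto
  next
    case False
    then have "j = 1" by (cases j) auto
    then have "vgen g v = 0" using that endo_zero[OF endo_vgen] by simp
    moreover have "0 \<in> part V i" for i using Omega_closed(1) by (cases i) auto
    ultimately show ?thesis by simp
  qed
  show "basis_ext (scl V) (\<lambda>k. vgen k v) (gen_bracket g h)
      = vgen g (vgen h v) - scl V (koszul (gen_parity g) (gen_parity h)) (vgen h (vgen g v))"
    if "v \<in> carr V" for g h v
  proof -
    have v: "v \<in> carr M" using that Omega_carr by simp
    note ext = basis_ext_add[OF vector_space_M] basis_ext_scale[OF vector_space_M]
      basis_ext_single[OF vector_space_M]
    note zero = endo_zero[OF endo_L'] endo_zero[OF endo_C']
    show ?thesis
      using L'_bracket[OF v] C'_L'[OF v]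
      by (cases g; cases h) (simp_all add: ext zero koszul_def)
  qed
qed (use Omega_carr endo_simps[OF endo_vgen] in auto)

text \<open>Positive \<open>Lbar\<close> modes kill vacuum vectors, so positive \<open>L'\<close>
  modes agree there with those of \<open>M\<close> and the same bound works.\<close>

lemma smooth_V: "smooth_vir V"
  unfolding smooth_vir_def
proof
  fix v assume "v \<in> carr V"
  then have v: "v \<in> \<Omega>" by simp
  then obtain n :: nat where n: "\<And>i. i > int n \<Longrightarrow> act M (bv (L i)) v = 0"
    using smooth Omega_carr unfolding smooth_fv_def by blast
  have "act V (bv (L i)) v = 0" if "i > int n" for i
    using n[OF that] Lbar_vacuum[OF Omega_carr[OF v] phi_vac[OF Omega_vac[OF v]], of i] that
    by (simp add: act_V_left L'_def)
  then show "\<exists>n::nat. \<forall>i>int n. act V (bv (L i)) v = 0" by blast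
qed

end

section \<open>Submodules generated by vacuum vectors, and simplicity of the multiplicity
  space\<close>

context fv_module
begin

text \<open>Write \<open>L k\<close> as \<open>Lbar k\<close> plus \<open>L' k\<close>: the first
  acts on the Fock factor, the second passes through \<open>fock_map\<close> to \<open>v\<close>,
  and \<open>C\<close> splits likewise. \<open>Psi\<close> and \<open>Z\<close> act on the Fock
  factor alone, the twist supplying the factors \<open>r\<close> and \<open>r^2\<close>.\<close>

lemma act_fock_map:
  assumes v: "v \<in> \<Omega>"
  shows "act M y (fock_map x v) = fock_map (twact r y x) v + fock_map x (act V y v)"
proof (induction y rule: finsupp_induct)
  case zero
  show ?case using Omega_carr[OF v]
    by (simp add: act_left twact_left act_V_left endo_zero[OF endo_fock_map])
next
  case (basis g)
  have vM: "v \<in> carr M" using Omega_carr[OF v] .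
  then have xv: "fock_map x v \<in> carr M" by simp
  show ?case
  proof (cases g)
    case (L k)
    have "act M (bv (L k)) (fock_map x v) = Lbar k (fock_map x v) + L' k (fock_map x v)"
      by (simp add: L'_def)
    then show ?thesis
      using L by (simp add: twact_gens act_V_left Lbar_fock_map[OF Omega_vac[OF v]]
        fock_map_commute[OF endo_L' L'_phi vM])
  next
    case (Psi n)
    then show ?thesis
      by (simp add: act_Psi[OF xv] phi_fock_map[OF Omega_vac[OF v]] twact_gens act_V_left
        fock_map_left endo_zero[OF endo_fock_map])
  next
    case C
    have "act M (bv C) (fock_map x v) = (1/2) \<cdot> fock_map x v + C' (fock_map x v)"
      by (simp add: C'_def)
    then show ?thesis
      using C by (simp add: twact_gens act_V_left fock_map_left fock_map_commute[OF endo_C' C'_phi vM])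
  next
    case Z
    then show ?thesis
      by (simp add: act_Z[OF xv] twact_gens act_V_left root fock_map_left endo_zero[OF endo_fock_map])
  qed
next
  case (add y z)
  have "act V w v \<in> carr M" for w
    by (rule act_V_in[OF subspace_S]) (rule endo_in[OF endo_vgen Omega_carr[OF v]])
  with add show ?case using Omega_carr[OF v]
    by (simp add: act_left twact_left act_V_left fock_map_left endo_add[OF endo_fock_map])
next
  case (scale c y)
  have "act V w v \<in> carr M" for w
    by (rule act_V_in[OF subspace_S]) (rule endo_in[OF endo_vgen Omega_carr[OF v]])
  with scale show ?case using Omega_carr[OF v]
    by (simp add: act_left twact_left act_V_left fock_map_left endo_scale[OF endo_fock_map] scale_right_distrib)
qed

lemma fock_map_representation:
  assumes U: "subspace U" "U \<subseteq> \<Omega>" and t: "t \<in> span {fock_map x u | x u. u \<in> U}"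
  shows "\<exists>K w. finite K \<and> (\<forall>A. w A \<in> U) \<and> (\<forall>A. A \<notin> K \<longrightarrow> w A = 0)
    \<and> t = (\<Sum>A\<in>K. mono (fset A) (w A))"
proof -
  have "\<exists>K w. finite K \<and> (\<forall>A. w A \<in> U) \<and> (\<forall>A. A \<notin> K \<longrightarrow> w A = 0)
    \<and> t = (\<Sum>A\<in>K. fock_map (bv A) (w A))"
    using Omega_carr[OF subsetD[OF U(2)]]
    by (intro span_bilinear_representation[OF vector_space_M vector_space_M U(1) _ _ _ _ t])
       (simp_all add: fock_map_left endo_add[OF endo_fock_map] endo_scale[OF endo_fock_map])
  then show ?thesis by simp
qed

lemma fock_map_independent:
  assumes "finite K" "\<And>A. w A \<in> \<Omega>" "(\<Sum>A\<in>K. mono (fset A) (w A)) = 0" "A \<in> K"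
  shows "w A = 0"
proof -
  let ?B = "\<Union>A\<in>K. fset A"
  have "\<forall>A\<in>K. w A = 0"
  proof (rule mono_independent[of ?B K fset])
    show "inj_on fset K" by (simp add: inj_on_def fset_inject)
    show "w A \<in> vac \<inter> part M 0" for A using assms(2)[of A] by (simp add: \<Omega>_def)
  qed (use assms in auto)
  then show ?thesis using assms(4) by blast
qed

text \<open>Stability under the action is read off from \<open>act_fock_map\<close>. The span is
  graded because \<open>U\<close> is even, so splitting \<open>x\<close> by parity splits
  \<open>fock_map x u\<close>.\<close>

lemma graded_submodule_fock_map:
  assumes U: "subspace U" "U \<subseteq> \<Omega>" and stable: "\<And>g u. u \<in> U \<Longrightarrow> vgen g u \<in> U"
  shows "graded_submodule fermion_virasoro M (span {fock_map x u | x u. u \<in> U})"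
proof -
  let ?X = "{fock_map x u | x u. u \<in> U}"
  let ?N = "span ?X"
  note carrU = Omega_carr[OF subsetD[OF U(2)]] and evenU = Omega_even[OF subsetD[OF U(2)]]
  have N_carr: "?N \<subseteq> carr M"
    by (rule span_minimal[OF _ subspace_S]) (use carrU in auto)
  have act_N: "act M y n \<in> ?N" if "n \<in> ?N" for y n
  proof -
    from that have "n \<in> ?N \<and> act M y n \<in> ?N"
    proof (induction rule: span_induct_alt)
      case base
      then show ?case by (simp add: act_simps span_zero)
    next
      case (step c p n)
      then obtain x u where p: "p = fock_map x u" and u: "u \<in> U" by blast
      have "act V y u \<in> U" using stable[OF u] by (intro act_V_in U(1))
      then have "act M y p \<in> ?N"
        unfolding p act_fock_map[OF subsetD[OF U(2) u]] using u by (intro span_add) (blast intro: span_base)+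
      moreover have "p \<in> ?N" using step(1) by (rule span_base)
      moreover from this have "p \<in> carr M" "n \<in> carr M" using step(2) N_carr by blast+
      then have "act M y (c \<cdot> p + n) = c \<cdot> act M y p + act M y n" by (simp add: act_simps)
      ultimately show ?case using step(2) by (simp add: span_add span_scale)
    qed
    then show ?thesis ..
  qed
  \<comment> \<open>It suffices to write each element as a sum of homogeneous elements of the span;
    directness of the grading then identifies them with the given components.\<close>
  have dec: "\<exists>a\<in>?N \<inter> part M 0. \<exists>b\<in>?N \<inter> part M 1. n = a + b" if "n \<in> ?N" for n
    using that
  proof (induction rule: span_induct_alt)
    case base
    have zero: "0 \<in> ?N \<inter> part M i" for i using span_zero P_closed(1) by blast
    show ?case by (rule bexI[OF _ zero], rule bexI[OF _ zero]) simp
  next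
    case (step c p n)
    then obtain x u a b where p: "p = fock_map x u" and u: "u \<in> U"
      and a: "a \<in> ?N \<inter> part M 0" and b: "b \<in> ?N \<inter> part M 1" and n: "n = a + b" by blast
    have "x \<in> carr (twist r fock)" by (simp add: carr_twist_fock)
    then obtain x0 x1 where x: "x0 \<in> ext_part 0" "x1 \<in> ext_part 1" "x = x0 + x1"
      by (auto simp: carr_def twist_def fock_def)
    have N: "fock_map x0 u \<in> ?N" "fock_map x1 u \<in> ?N" using u by (blast intro: span_base)+
    have P: "fock_map x0 u \<in> part M 0" "fock_map x1 u \<in> part M 1"
      using fock_map_parity[OF x(1) evenU[OF u]] fock_map_parity[OF x(2) evenU[OF u]] by simp_all
    have "c \<cdot> fock_map x0 u + a \<in> ?N \<inter> part M 0" "c \<cdot> fock_map x1 u + b \<in> ?N \<inter> part M 1"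
      using N P a b by (auto intro: span_add span_scale P_closed)
    moreover have "c \<cdot> p + n = (c \<cdot> fock_map x0 u + a) + (c \<cdot> fock_map x1 u + b)"
      by (simp add: p n x(3) fock_map_left scale_right_distrib algebra_simps)
    ultimately show ?case
      by (intro bexI[of _ "c \<cdot> fock_map x0 u + a"] bexI[of _ "c \<cdot> fock_map x1 u + b"])
  qed
  have "a \<in> ?N \<and> b \<in> ?N" if ab: "a \<in> part M 0" "b \<in> part M 1" "a + b \<in> ?N" for a b
  proof -
    obtain a' b' where *: "a' \<in> ?N" "a' \<in> part M 0" "b' \<in> ?N" "b' \<in> part M 1" "a + b = a' + b'"
      using dec[OF ab(3)] by blast
    then have "(a - a') + (b - b') = 0" by (simp add: algebra_simps)
    then have "a - a' = 0 \<and> b - b' = 0"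
      using ab * by (intro even_plus_odd_zero P_closed)
    then show ?thesis using * by simp
  qed
  then show ?thesis
    unfolding graded_submodule_def using N_carr act_N by (simp add: subspace_span)
qed

lemma Omega_subset_fock_span: "U \<subseteq> span {fock_map x u | x u. u \<in> U}"
proof
  fix u assume "u \<in> U"
  moreover have "u = fock_map (bv {||}) u" by simp
  ultimately have "u \<in> {fock_map x u | x u. u \<in> U}" by blast
  then show "u \<in> span {fock_map x u | x u. u \<in> U}" by (rule span_base)
qed

text \<open>A submodule \<open>U\<close> generates a graded submodule of \<open>M\<close>. If this
  is all of \<open>M\<close>, an even vacuum vector expands into monomials with coefficients in
  \<open>U\<close>, and comparing coefficients at the empty monomial puts the vector itself into
  \<open>U\<close>.\<close>

lemma simple_V:
  assumes simple: "simple_module fermion_virasoro M"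
  shows "simple_module virasoro V"
  unfolding simple_module_def
proof (intro conjI allI impI)
  show "super_module virasoro V" by (rule super_module_virasoro[OF super_module_V])
  have "carr M \<noteq> {0}" using simple by (simp add: simple_module_def)
  from vacuum_exists[OF this] show "carr V \<noteq> {0}" by (auto simp: \<Omega>_def)
next
  fix U assume U: "graded_submodule virasoro V U"
  then have sub: "subspace U" and le: "U \<subseteq> \<Omega>" by (simp_all add: graded_submodule_def)
  have stable: "vgen g u \<in> U" if u: "u \<in> U" for g u
  proof (cases "g \<in> insert C (range L)")
    case True
    then have "bv g \<in> part virasoro 0" by (auto simp: virasoro_part)
    then have "bv g \<in> carr virasoro"
      using part_subset_carr lie_superalgebra_virasoro by (auto simp: lie_superalgebra_def)
    then have "act V (bv g) u \<in> U" using U u by (simp add: graded_submodule_def)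
    then show ?thesis by (simp add: act_V_left)
  next
    case False
    then show ?thesis using subspace_0[OF sub] by (cases g) auto
  qed
  let ?N = "span {fock_map x u | x u. u \<in> U}"
  have "?N = {0} \<or> ?N = carr M"
    using simple graded_submodule_fock_map[OF sub le stable] by (auto simp: simple_module_def)
  then show "U = {0} \<or> U = carr V"
  proof
    assume "?N = {0}"
    then show ?thesis using Omega_subset_fock_span[of U] subspace_0[OF sub] by auto
  next
    assume N: "?N = carr M"
    have "v \<in> U" if v: "v \<in> \<Omega>" for v
    proof -
      have "v \<in> ?N" using Omega_carr[OF v] N by simp
      then obtain K w where K: "finite K" "\<And>A. w A \<in> U" "\<And>A. A \<notin> K \<Longrightarrow> w A = 0"
          "v = (\<Sum>A\<in>K. mono (fset A) (w A))"
        using fock_map_representation[OF sub le] by blast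
      \<comment> \<open>Subtracting \<open>v\<close> at the empty monomial turns the expansion into
        a linear relation. The empty set is inserted because \<open>K\<close> may lack it.\<close>
      let ?K = "insert {||} K"
      let ?w = "\<lambda>A. w A - (if A = {||} then v else 0)"
      have w_carr: "w A \<in> carr M" for A using K(2) le Omega_carr by blast
      have "(\<Sum>A\<in>?K. mono (fset A) (?w A))
          = (\<Sum>A\<in>?K. mono (fset A) (w A)) - (\<Sum>A\<in>?K. if A = {||} then v else 0)"
        unfolding sum_subtractf[symmetric]
        using w_carr by (intro sum.cong) (auto simp: endo_diff[OF endo_mono])
      also have "(\<Sum>A\<in>?K. mono (fset A) (w A)) = v"
        unfolding K(4) by (rule sum.mono_neutral_right) (use K in \<open>auto simp: endo_zero[OF endo_mono]\<close>)
      also have "(\<Sum>A\<in>?K. if A = {||} then v else 0) = v" using K(1) by (simp add: sum.delta)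
      finally have sum_zero: "(\<Sum>A\<in>?K. mono (fset A) (?w A)) = 0" by simp
      have "w A \<in> \<Omega>" for A using K(2) le by blast
      then have "?w A \<in> \<Omega>" for A using v Omega_closed(1,3) by simp
      then have "?w {||} = 0"
        using K(1) by (intro fock_map_independent[OF _ _ sum_zero]) simp_all
      then show ?thesis using K(2)[of "{||}"] by simp
    qed
    then show ?thesis using le by auto
  qed
qed

section \<open>The isomorphism with the tensor product\<close>

abbreviation T :: "(fv, (ext, 'm) tensor) smodule" where
  "T \<equiv> tensor_module fermion_virasoro (twist r fock) V"

abbreviation pure :: "ext \<Rightarrow> 'm \<Rightarrow> (ext, 'm) tensor" where
  "pure \<equiv> pure_tensor (twist r fock) V"

lemma carr_T: "carr T = ts.span {pure x v | x v. v \<in> \<Omega>}"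
  using carr_tensor[OF super_vector_space_twist_fock super_vector_space_V, of fermion_virasoro r]
  by (simp add: carr_twist_fock)

lemma pure_bilinear:
  "v \<in> \<Omega> \<Longrightarrow> pure (x + y) v = pure x v + pure y v"
  "v \<in> \<Omega> \<Longrightarrow> pure (fscale c x) v = tensor_scale c (pure x v)"
  "v \<in> \<Omega> \<Longrightarrow> w \<in> \<Omega> \<Longrightarrow> pure x (v + w) = pure x v + pure x w"
  "v \<in> \<Omega> \<Longrightarrow> pure x (c \<cdot> v) = tensor_scale c (pure x v)"
  using bilinear_pure_tensor[of "twist r fock" V] unfolding bilinear_on_def
  by (simp_all add: carr_twist_fock) (simp add: twist_def fock_def)

lemma act_V_Omega: "v \<in> \<Omega> \<Longrightarrow> act V x v \<in> \<Omega>"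
  by (intro act_V_in subspace_Omega vgen_Omega)

text \<open>Odd elements of the algebra act by zero on \<open>V\<close>, so the Koszul signs
  disappear and the formula holds for inhomogeneous arguments as well.\<close>

lemma act_T_pure:
  assumes v: "v \<in> \<Omega>"
  shows "act T y (pure x v) = pure (twact r y x) v + pure x (act V y v)"
proof
  fix \<beta> :: "ext \<Rightarrow> 'm \<Rightarrow> complex"
  let ?A = "twist r fock"
  note svA = super_vector_space_twist_fock[of r]
  \<comment> \<open>The form at which the action evaluates a pure tensor. Its bilinearity has to be
    proved, because a pure tensor takes the value \<open>0\<close> on all other forms.\<close>
  define \<beta>' where "\<beta>' = (\<lambda>a b. \<beta> (twact r y a) b + (\<Sum>i\<in>{0, 1}. \<Sum>j\<in>{0, 1}. koszul i j *
     \<beta> (component ?A j a) (act V (component fermion_virasoro i y) b)))"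
  show "act T y (pure x v) \<beta> = (pure (twact r y x) v + pure x (act V y v)) \<beta>"
  proof (cases "bilinear_on ?A V (*) \<beta>")
    case True
    have scl: "scl ?A = fscale" by (simp add: twist_def fock_def)
    have \<beta>: "\<beta> (a + a') b = \<beta> a b + \<beta> a' b" "\<beta> (fscale c a) b = c * \<beta> a b"
        "b' \<in> \<Omega> \<Longrightarrow> \<beta> a (b + b') = \<beta> a b + \<beta> a b'" "\<beta> a (c \<cdot> b) = c * \<beta> a b"
      if "b \<in> \<Omega>" for a a' b b' c
      using True that unfolding bilinear_on_def by (simp_all add: carr_twist_fock scl)
    note comp = component_props(2,3)[OF svA, unfolded carr_twist_fock scl, OF UNIV_I]
    have V: "act V z (b + b') = act V z b + act V z b'" "act V z (c \<cdot> b) = c \<cdot> act V z b"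
      if "b \<in> \<Omega>" "b' \<in> \<Omega>" for z b b' c
      using that Omega_carr act_V_right by blast+
    have "bilinear_on ?A V (*) \<beta>'"
      unfolding bilinear_on_def \<beta>'_def carr_twist_fock scl V_sel
      by (simp add: comp \<beta> V act_V_Omega twact_right Omega_closed algebra_simps)
    moreover have "\<beta>' x v = \<beta> (twact r y x) v + \<beta> x (act V y v)"
    proof -
      obtain y0 y1 where y: "y0 \<in> part fermion_virasoro 0" "y1 \<in> part fermion_virasoro (0 + 1)" "y = y0 + y1"
        using carr_decompose[OF super_vector_space_fv] carr_fv by blast
      have c0: "component fermion_virasoro 0 y = y0"
        using component_eq[OF super_vector_space_fv y(1,2)] y(3) by simp
      have "component fermion_virasoro 1 y = y1"
        using component_eq[OF super_vector_space_fv, of y1 1 y0] y by (simp add: add.commute)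
      moreover have "act V y1 v = 0"
        unfolding act_V basis_ext_def
      proof (rule sum.neutral, rule ballI)
        fix g assume "g \<in> Poly_Mapping.keys y1"
        then have "gen_parity g = 1" using y(2) by (simp add: fv_part_iff)
        then show "Poly_Mapping.lookup y1 g \<cdot> vgen g v = 0" by (cases g) auto
      qed
      moreover obtain x0 x1 where x: "x0 \<in> part ?A 0" "x1 \<in> part ?A (0 + 1)" "x = x0 + x1"
        using carr_decompose[OF svA] carr_twist_fock by blast
      moreover have "component ?A 0 x = x0" "component ?A 1 x = x1"
        using component_eq[OF svA x(1,2)] component_eq[OF svA, of x1 1 x0] x by (simp_all add: add.commute)
      moreover have "\<beta> a 0 = 0" for a using \<beta>(4)[of 0 a 0] Omega_closed(1) by simp
      ultimately show ?thesis
        unfolding \<beta>'_def using v c0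
        by (simp add: koszul_def y(3) act_V_left \<beta> act_V_Omega)
    qed
    moreover have "act T y (pure x v) \<beta> = pure x v \<beta>'"
      using True by (simp only: tensor_module_def smodule.simps \<beta>'_def if_True)
    ultimately show ?thesis
      using True by (simp add: pure_tensor_def)
  qed (simp add: tensor_module_def pure_tensor_def)
qed

lemma act_T_linear: "act T y (tensor_scale c p + q) = tensor_scale c (act T y p) + act T y q"
  by (auto simp: tensor_module_def tensor_scale_def)

lemma scl_T: "scl T = tensor_scale"
  by (simp add: tensor_module_def)

text \<open>The universal property turns \<open>fock_map\<close> into a homomorphism
  \<open>h\<close> from \<open>T\<close> to \<open>M\<close>. Independence of monomials makes it
  injective and simplicity of \<open>M\<close> makes it surjective; its inverse is the required
  isomorphism.\<close>

lemma module_iso_T: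
  assumes simple: "simple_module fermion_virasoro M"
  shows "module_iso fermion_virasoro M T"
proof -
  have bil: "bilinear_on (twist r fock) V (scl M) fock_map"
    using Omega_carr unfolding bilinear_on_def
    by (simp add: fock_map_left endo_add[OF endo_fock_map] endo_scale[OF endo_fock_map])
       (simp add: twist_def fock_def fock_map_left)
  obtain h where h: "\<forall>t\<in>carr T. \<forall>t'\<in>carr T. h (t + t') = h t + h t'"
      "\<forall>c. \<forall>t\<in>carr T. h (tensor_scale c t) = c \<cdot> h t"
      "\<forall>x\<in>carr (twist r fock). \<forall>v\<in>carr V. h (pure x v) = fock_map x v"
    using tensor_universal(1)[OF super_vector_space_twist_fock super_vector_space_V vector_space_M bil,
        of fermion_virasoro] by blast
  then have h_add: "\<And>t t'. t \<in> carr T \<Longrightarrow> t' \<in> carr T \<Longrightarrow> h (t + t') = h t + h t'"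
    and h_scale: "\<And>c t. t \<in> carr T \<Longrightarrow> h (tensor_scale c t) = c \<cdot> h t"
    and h_pure: "\<And>x v. v \<in> \<Omega> \<Longrightarrow> h (pure x v) = fock_map x v"
    by (simp_all add: carr_twist_fock)
  have subT: "ts.subspace (carr T)" unfolding carr_T by (rule ts.subspace_span)
  note T_closed = ts.subspace_0[OF subT] ts.subspace_add[OF subT] ts.subspace_scale[OF subT] ts.subspace_sum[OF subT]
  have pure_in: "pure x v \<in> carr T" if "v \<in> \<Omega>" for x v
    unfolding carr_T using that by (blast intro: ts.span_base)
  have h_zero: "h 0 = 0" using h_scale[OF T_closed(1), of 0] by simp
  have h_sum: "h (\<Sum>i\<in>I. f i) = (\<Sum>i\<in>I. h (f i))" if "finite I" "\<And>i. i \<in> I \<Longrightarrow> f i \<in> carr T" for I and f :: "nat fset \<Rightarrow> _"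
    using that by (induction I) (auto simp: h_zero h_add T_closed)
  \<comment> \<open>The claims are proved together because \<open>h\<close> is additive only on the
    carrier, so the induction has to carry the memberships along.\<close>
  have hom: "act T y t \<in> carr T \<and> h (act T y t) = act M y (h t) \<and> h t \<in> carr M" if "t \<in> carr T" for y t
  proof -
    from that have "t \<in> ts.span {pure x v | x v. v \<in> \<Omega>}" by (simp only: carr_T)
    then have "t \<in> carr T \<and> act T y t \<in> carr T \<and> h (act T y t) = act M y (h t) \<and> h t \<in> carr M"
    proof (induction rule: ts.span_induct_alt)
      case base
      have "act T y 0 = 0" using act_T_linear[of y 0 0 0] by (simp add: tensor_module_def zero_fun_def)
      then show ?case using T_closed(1) h_zero act_simps(6) S_closed(1) by metis
    next
      case (step c p t)
      then obtain x v where p: "p = pure x v" and v: "v \<in> \<Omega>" by blast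
      have p_in: "p \<in> carr T" "h p \<in> carr M" using p v Omega_carr[OF v] by (simp_all add: pure_in h_pure)
      have act_p: "act T y p \<in> carr T"
        unfolding p act_T_pure[OF v] using v by (intro T_closed pure_in act_V_Omega)
      have h_act_p: "h (act T y p) = act M y (h p)"
        unfolding p act_T_pure[OF v] using v act_V_Omega[OF v]
        by (simp add: h_add pure_in h_pure act_fock_map)
      note IH = step(2)
      have "tensor_scale c p + t \<in> carr T" using p_in IH by (blast intro: T_closed)
      moreover have "act T y (tensor_scale c p + t) \<in> carr T"
        unfolding act_T_linear using act_p IH by (blast intro: T_closed)
      moreover have "h (tensor_scale c p + t) = c \<cdot> h p + h t"
        using p_in IH by (simp only: h_add h_scale T_closed)
      moreover have "h (act T y (tensor_scale c p + t)) = c \<cdot> h (act T y p) + h (act T y t)"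
        unfolding act_T_linear using act_p IH by (simp only: h_add h_scale T_closed)
      ultimately have "tensor_scale c p + t \<in> carr T \<and> act T y (tensor_scale c p + t) \<in> carr T
          \<and> h (act T y (tensor_scale c p + t)) = act M y (h (tensor_scale c p + t))
          \<and> h (tensor_scale c p + t) \<in> carr M"
        using p_in IH h_act_p by (simp add: act_simps)
      then show ?case .
    qed
    then show ?thesis by blast
  qed
  \<comment> \<open>A tensor is a sum of pure tensors with distinct basis monomials on the left; if
    \<open>h\<close> kills it, independence forces all right factors to vanish.\<close>
  have h_inj: "t = 0" if t: "t \<in> carr T" "h t = 0" for t
  proof -
    have "\<exists>K w. finite K \<and> (\<forall>A. w A \<in> \<Omega>) \<and> (\<forall>A. A \<notin> K \<longrightarrow> w A = 0) \<and> t = (\<Sum>A\<in>K. pure (bv A) (w A))"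
      by (rule span_bilinear_representation[OF vector_space_M ts.vector_space_axioms subspace_Omega _ _ _ _
            t(1)[unfolded carr_T]]; rule pure_bilinear; assumption)
    then obtain K w where K: "finite K" "\<And>A. w A \<in> \<Omega>" "t = (\<Sum>A\<in>K. pure (bv A) (w A))" by blast
    have "h t = (\<Sum>A\<in>K. mono (fset A) (w A))"
      unfolding K(3) using K(1,2) by (simp add: h_sum pure_in h_pure)
    then have "w A = 0" if "A \<in> K" for A
      using fock_map_independent[OF K(1,2) _ that] t(2) by simp
    moreover have "pure x 0 = 0" for x using pure_bilinear(4)[OF Omega_closed(1), of x 0] by simp
    ultimately show ?thesis unfolding K(3) by simp
  qed
  have inj: "inj_on h (carr T)"
  proof (rule inj_onI)
    fix t t' assume *: "t \<in> carr T" "t' \<in> carr T" "h t = h t'"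
    have "h t = h (t - t') + h t'"
      using h_add[OF ts.subspace_diff[OF subT *(1,2)] *(2)] by simp
    then have "t - t' = 0"
      using * by (intro h_inj ts.subspace_diff[OF subT]) simp_all
    then show "t = t'" by simp
  qed
  have surj: "h ` carr T = carr M"
  proof
    show "h ` carr T \<subseteq> carr M" using hom by blast
    let ?N = "span {fock_map x u | x u. u \<in> \<Omega>}"
    \<comment> \<open>The span contains a nonzero vacuum vector and is a graded submodule, so it is
      all of \<open>M\<close>.\<close>
    have "?N \<noteq> {0}"
      using vacuum_exists simple Omega_subset_fock_span[of \<Omega>]
      by (auto simp: simple_module_def \<Omega>_def)
    then have N: "?N = carr M"
      using simple graded_submodule_fock_map[OF subspace_Omega order_refl vgen_Omega]
      by (auto simp: simple_module_def)
    have sub: "subspace (h ` carr T)"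
    proof (rule subspaceI)
      show "0 \<in> h ` carr T" using h_zero T_closed(1) by force
      fix u assume "u \<in> h ` carr T"
      then obtain t where t: "t \<in> carr T" "u = h t" by blast
      show "c \<cdot> u \<in> h ` carr T" for c
        unfolding t(2) h_scale[OF t(1), symmetric] by (intro imageI T_closed t(1))
      fix v assume "v \<in> h ` carr T"
      then obtain t' where t': "t' \<in> carr T" "v = h t'" by blast
      show "u + v \<in> h ` carr T"
        unfolding t(2) t'(2) h_add[OF t(1) t'(1), symmetric] by (intro imageI T_closed t(1) t'(1))
    qed
    have "fock_map x u \<in> h ` carr T" if "u \<in> \<Omega>" for x u
      unfolding h_pure[OF that, symmetric] by (intro imageI pure_in that)
    then have "?N \<subseteq> h ` carr T" by (intro span_minimal sub) blast
    then show "carr M \<subseteq> h ` carr T" by (simp only: N)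
  qed
  have part_T: "part T k = ts.span {pure a b | a b i j. a \<in> ext_part i \<and> b \<in> part V j \<and> i + j = k}" for k
    by (simp add: tensor_module_def twist_def fock_def)
  have part_carr: "part T k \<subseteq> carr T" for k
    unfolding part_T carr_T
  proof (rule ts.span_mono, rule subsetI)
    fix p assume "p \<in> {pure a b | a b i j. a \<in> ext_part i \<and> b \<in> part V j \<and> i + j = k}"
    then obtain a b j where "p = pure a b" "b \<in> part V j" by blast
    moreover have "part V j \<subseteq> \<Omega>" using Omega_closed(1) by (cases j) auto
    ultimately show "p \<in> {pure x v | x v. v \<in> \<Omega>}" by blast
  qed
  have h_part: "h t \<in> part M k" if "t \<in> part T k" for k t
  proof -
    from that have "t \<in> carr T \<and> h t \<in> part M k" unfolding part_T
    proof (induction rule: ts.span_induct_alt)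
      case base
      have "0 \<in> carr T \<and> h 0 \<in> part M k" by (simp add: h_zero T_closed P_closed)
      then show ?case .
    next
      case (step c p t)
      then obtain a b i j where p: "p = pure a b" and ab: "a \<in> ext_part i" "b \<in> part V j" "i + j = k" by blast
      have "h p \<in> part M k"
      proof (cases "j = 0")
        case True
        then show ?thesis using ab fock_map_parity[OF ab(1) Omega_even, of b] by (simp add: p h_pure)
      next
        case False
        then have "j = 1" by (cases j) auto
        then have "b = 0" using ab by simp
        then show ?thesis
          by (simp add: p h_pure Omega_closed endo_zero[OF endo_fock_map] P_closed)
      qed
      moreover have "p \<in> carr T"
        using subsetD[OF part_carr, of p k] ts.span_base[OF step(1)] unfolding part_T .
      ultimately have "tensor_scale c p + t \<in> carr T \<and> h (tensor_scale c p + t) \<in> part M k"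
        using step(2) by (simp add: T_closed h_add h_scale P_closed)
      then show ?case .
    qed
    then show ?thesis ..
  qed
  define f where "f = inv_into (carr T) h"
  have f_in: "f v \<in> carr T" and h_f: "h (f v) = v" if "v \<in> carr M" for v
    using that inv_into_into[of v h "carr T"] f_inv_into_f[of v h "carr T"] unfolding f_def surj by simp_all
  have f_eq: "f v = t" if "t \<in> carr T" "h t = v" for v t
    unfolding f_def using that inj by (simp add: inv_into_f_eq)
  have "linear_between M T f"
    unfolding linear_between_def scl_T
    by (auto intro!: f_eq simp: f_in h_f h_add h_scale T_closed)
  moreover have "bij_betw f (carr M) (carr T)"
    unfolding f_def using inj surj by (intro bij_betw_inv_into) (simp add: bij_betw_def)
  \<comment> \<open>Since \<open>h\<close> preserves parity, it sends the component of
    \<open>f v\<close> of the wrong degree to zero, and injectivity makes that component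
    vanish.\<close>
  moreover have "f v \<in> part T i" if v: "v \<in> part M i" for i v
  proof -
    have vM: "v \<in> carr M" using v by (rule P_in)
    then obtain t0 t1 where t: "t0 \<in> part T 0" "t1 \<in> part T 1" "f v = t0 + t1"
      using f_in[OF vM] unfolding carr_def[of T] by blast
    have tT: "t0 \<in> carr T" "t1 \<in> carr T" using t part_carr by blast+
    have v_eq: "v = h t0 + h t1" using h_f[OF vM] t(3) tT by (simp add: h_add)
    note ht = h_part[OF t(1)] h_part[OF t(2)]
    show ?thesis
    proof (cases "i = 0")
      case True
      have "(h t0 - v) + h t1 = 0" by (simp add: v_eq)
      then have "h t1 = 0"
        using even_plus_odd_zero[of "h t0 - v" "h t1"] ht v True P_closed(4) by blast
      then show ?thesis using h_inj[OF tT(2)] t True by simp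
    next
      case False
      then have i: "i = 1" by (cases i) auto
      have "h t0 + (h t1 - v) = 0" by (simp add: v_eq)
      then have "h t0 = 0"
        using even_plus_odd_zero[of "h t0" "h t1 - v"] ht v i P_closed(4) by blast
      then show ?thesis using h_inj[OF tT(1)] t i by simp
    qed
  qed
  moreover have "f (act M x v) = act T x (f v)" if "v \<in> carr M" for x v
    using hom[OF f_in[OF that], of x] h_f[OF that] by (intro f_eq) auto
  ultimately show ?thesis unfolding module_iso_def by blast
qed

end

theorem theorem4p3:
  fixes M :: "(fv, 'm::ab_group_add) smodule" and l :: complex
  assumes "simple_module fermion_virasoro M" and "smooth_fv M"
    and "l \<noteq> 0" and "has_level M l"
  shows "\<exists>(V :: (fv, 'm) smodule) (r :: complex).
           simple_module virasoro V \<and> smooth_vir V \<and> r\<^sup>2 = l \<and>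
           module_iso fermion_virasoro M
             (tensor_module fermion_virasoro (twist r fock) (inflate V))"
proof -
  \<comment> \<open>The principal root is one choice; the locale asks only for
    \<open>r^2 = l\<close>.\<close>
  interpret fv_module M l "csqrt l"
    using assms by unfold_locales (simp_all add: simple_module_def)
  show ?thesis
    using simple_V[OF assms(1)] smooth_V module_iso_T[OF assms(1)]
    by (intro exI[of _ V] exI[of _ "csqrt l"]) (simp add: inflate_V)
qed

end
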